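(* Let $n\ge 2$ be an integer, let $\varepsilon$ be a positive real number and let $a_1,\ldots ,a_n$ be non-zero rational numbers. There exists a positive number $s_0$, which is effectively computable in terms of $\varepsilon$ and $a_1,\ldots ,a_n$, with the property that for every integer $s\geq s_0$ there is a set of primes $S$ of cardinality $s$ such that the equation $$a_1x_1+a_2x_2+\cdots +a_nx_n=1\quad\text{in $S$-units } x_1,\ldots ,x_n$$ has at least $$\exp\Big\{(1-\varepsilon )\frac{n^2}{n-1}\, s^{1-1/n}(\log s)^{-1/n}\Big\}$$ non-degenerate solutions $(x_1,\ldots ,x_n)$.
   Context: For a set $S$ of (rational) prime numbers, an $S$-unit is a non-zero rational number (of either sign) such that both the denominator and the numerator of its simplified representation are composed of primes from $S$. A solution $(x_1,\ldots ,x_n)$ of $a_1x_1+\cdots +a_nx_n=1$ is called degenerate if there is some non-empty proper subset $\{i_1,\ldots ,i_k\}$ of $\{1,\ldots ,n\}$ such that $a_{i_1}x_{i_1}+\cdots +a_{i_k}x_{i_k}=0$, and non-degenerate otherwise. *)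

theory Defs
  imports Complex_Main "HOL-Library.Nat_Bijection" "HOL-Computational_Algebra.Primes"
begin

section \<open>Effective computability\<close>

text \<open>
  Partial recursive functions relative to an oracle. The oracle supplies a real argument of an
  algorithm through rational approximations; all other inputs are natural numbers.
\<close>

datatype program =
    Zero
  | Successor
  | Proj nat
  | Query
  | Comp program "program list"
  | PrimRec program program
  | Mu program

text \<open>
  \<open>computes \<phi> P xs y\<close>: with oracle \<open>\<phi>\<close>, program \<open>P\<close> halts on input \<open>xs\<close> with output \<open>y\<close>.
  In \<open>mu\<close>, the search halts at \<open>n\<close> only if the body halts with a non-zero value at all \<open>m < n\<close>.
\<close>

inductive computes :: "(nat \<Rightarrow> nat) \<Rightarrow> program \<Rightarrow> nat list \<Rightarrow> nat \<Rightarrow> bool" for \<phi> where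
  zero: "computes \<phi> Zero xs 0"
| successor: "computes \<phi> Successor [x] (Suc x)"
| proj: "i < length xs \<Longrightarrow> computes \<phi> (Proj i) xs (xs ! i)"
| query: "computes \<phi> Query [x] (\<phi> x)"
| comp: "list_all2 (\<lambda>g y. computes \<phi> g xs y) gs ys \<Longrightarrow> computes \<phi> f ys z
    \<Longrightarrow> computes \<phi> (Comp f gs) xs z"
| primrec_0: "computes \<phi> f xs y \<Longrightarrow> computes \<phi> (PrimRec f g) (0 # xs) y"
| primrec_Suc: "computes \<phi> (PrimRec f g) (n # xs) y \<Longrightarrow> computes \<phi> g (n # y # xs) z
    \<Longrightarrow> computes \<phi> (PrimRec f g) (Suc n # xs) z"
| mu: "computes \<phi> f (n # xs) 0 \<Longrightarrow> \<forall>m<n. \<exists>y. computes \<phi> f (m # xs) (Suc y)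
    \<Longrightarrow> computes \<phi> (Mu f) xs n"

inductive_cases computes_elims:
  "computes \<phi> Zero xs y"
  "computes \<phi> Successor xs y"
  "computes \<phi> (Proj i) xs y"
  "computes \<phi> Query xs y"
  "computes \<phi> (Comp f gs) xs y"
  "computes \<phi> (PrimRec f g) (0 # xs) y"
  "computes \<phi> (PrimRec f g) (Suc n # xs) y"
  "computes \<phi> (Mu f) xs y"

lemma computes_deterministic:
  "computes \<phi> P xs y \<Longrightarrow> computes \<phi> P xs z \<Longrightarrow> y = z"
proof (induction P xs y arbitrary: z rule: computes.induct)
  case (comp xs gs ys f w)
  from comp.prems obtain ys' where ys': "list_all2 (\<lambda>g y. computes \<phi> g xs y) gs ys'"
    and f: "computes \<phi> f ys' z"
    by (blast elim: computes_elims)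
  have "ys = ys'"
    using comp.IH(1) ys' by (auto simp: list_all2_conv_all_nth intro!: nth_equalityI)
  with f comp.IH(2) show ?case by simp
next
  case (primrec_Suc f g n xs y w)
  from primrec_Suc.prems obtain y' where "computes \<phi> (PrimRec f g) (n # xs) y'"
    and "computes \<phi> g (n # y' # xs) z"
    by (blast elim: computes_elims)
  with primrec_Suc.IH show ?case by metis
next
  case (mu f n xs)
  from mu.prems have z: "computes \<phi> f (z # xs) 0"
      "\<forall>m<z. \<exists>y. computes \<phi> f (m # xs) (Suc y)"
    by (blast elim: computes_elims)+
  show ?case
  proof (rule linorder_cases[of n z])
    assume "n < z"
    with z(2) mu.IH(1) show ?thesis by blast
  next
    assume "z < n"
    with z(1) mu.IH(2) show ?thesis by blast
  qed
qed (blast elim: computes_elims)+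

definition rat_code :: "rat \<Rightarrow> nat" where
  "rat_code q = prod_encode (int_encode (fst (quotient_of q)), nat (snd (quotient_of q)))"

definition rat_list_code :: "rat list \<Rightarrow> nat" where
  "rat_list_code qs = list_encode (map rat_code qs)"

text \<open>
  An oracle representing the real number \<open>r\<close> answers the query \<open>k\<close> with (the code of)
  a rational approximation of \<open>r\<close> to within \<open>2 ^ -k\<close>.
\<close>

definition represents_real :: "(nat \<Rightarrow> nat) \<Rightarrow> real \<Rightarrow> bool" where
  "represents_real \<phi> r \<longleftrightarrow>
     (\<forall>k. \<exists>q. \<phi> k = rat_code q \<and> \<bar>of_rat q - r\<bar> \<le> 1 / 2 ^ k)"

section \<open>Solutions of linear equations in S-units\<close>

definition S_unit :: "nat set \<Rightarrow> rat \<Rightarrow> bool" where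
  "S_unit S x \<longleftrightarrow> x \<noteq> 0 \<and>
     (\<forall>p::nat. prime p \<and> (int p dvd fst (quotient_of x) \<or> int p dvd snd (quotient_of x))
        \<longrightarrow> p \<in> S)"

definition S_unit_solution :: "nat set \<Rightarrow> rat list \<Rightarrow> rat list \<Rightarrow> bool" where
  "S_unit_solution S a x \<longleftrightarrow> length x = length a \<and> (\<forall>i<length x. S_unit S (x ! i)) \<and>
     (\<Sum>i<length a. a ! i * x ! i) = 1"

definition degenerate :: "rat list \<Rightarrow> rat list \<Rightarrow> bool" where
  "degenerate a x \<longleftrightarrow>
     (\<exists>I. I \<noteq> {} \<and> I \<subset> {..<length a} \<and> (\<Sum>i\<in>I. a ! i * x ! i) = 0)"

end

theory Submission
  imports Defs "HOL-Analysis.Analysis"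
begin

text \<open>
  Once \<open>S\<close> contains the primes of the coefficients, it suffices to count solutions of
  \<open>w\<^sub>1 + \<dots> + w\<^sub>n = q r\<close> with a fixed integer \<open>r\<close>, smooth \<open>q\<close> and smooth \<open>w\<^sub>i\<close>, where
  \<open>q\<close> and the \<open>w\<^sub>i\<close> are built from two disjoint sets of primes: dividing by \<open>q r\<close> then
  keeps the solutions distinct. As in the argument of Konyagin and Soundararajan for \<open>n = 2\<close>,
  the divisor \<open>q\<close> is allowed to vary. For \<open>n = 2 k\<close>, Cauchy--Schwarz yields, for every \<open>q\<close>,
  many congruences \<open>x\<^sub>1 + \<dots> + x\<^sub>k \<equiv> y\<^sub>1 + \<dots> + y\<^sub>k\<close> modulo \<open>q\<close> between smooth numbers; for
  \<open>n = 2 k + 1\<close> a further term \<open>c z\<close> or \<open>q z\<close> with smooth \<open>z\<close> is added. The pigeonhole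
  principle then selects the cofactor \<open>r\<close>, which has few prime factors. The variation of
  \<open>q\<close> gains a factor \<open>log s\<close> in the exponent over what is required, so that the
  Chebyshev lower bound for the number of primes and crude estimates suffice.
\<close>

section \<open>Lower bound for the number of primes\<close>

text \<open>What varying \<open>q\<close> gains can be read off a count. Congruent pairs have
  density about \<open>1 / q\<close>, while the cofactor \<open>r\<close> ranges over about
  \<open>X / q\<close> values, where \<open>X = 2 ^ \<xi>\<close> bounds the summands. So the size
  of \<open>q\<close> cancels, and for even \<open>n\<close> some cofactor receives about
  \<open>card Q * card A ^ n / X\<close> equations. For the parameters chosen below,
  \<open>card A ^ n\<close> is smaller than \<open>X\<close> by the factor
  \<open>2 ^ (2 * (n + 1)\<^sup>2 * t * u)\<close>, and \<open>card Q\<close> has to make this up.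
  The cofactor must be common to all equations because its primes enter \<open>S\<close>; being at
  most \<open>n * X\<close>, it has far fewer prime factors than there are primes in the
  construction. Degenerate solutions are rare: a vanishing subsum determines one summand from the
  others and costs a factor \<open>card A\<close>, which is larger than every \<open>q\<close>. The
  obstacle is odd \<open>n\<close>. Cauchy--Schwarz bounds from below how often a difference of two
  k-fold sums is 0 modulo \<open>q\<close>, but not how often it hits a prescribed nonzero residue.
  Averaging over small multiples of that residue leads to two alternatives, either of which yields
  enough equations.\<close>

lemma multiplicity_eq_card_powers:
  fixes p n :: nat
  assumes "prime p" "n > 0" "n < p ^ K"
  shows "multiplicity p n = card {i \<in> {1..<K}. p ^ i dvd n}"
proof -
  have "p ^ i dvd n \<longleftrightarrow> i \<le> multiplicity p n" for i
    using assms(2) prime_gt_1_nat[OF assms(1)] by (intro power_dvd_iff_le_multiplicity) simp_all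
  moreover have "multiplicity p n < K"
  proof -
    have "p ^ multiplicity p n \<le> n"
      using assms(2) by (intro dvd_imp_le multiplicity_dvd)
    also note assms(3)
    finally show ?thesis
      by (rule power_less_imp_less_exp[OF prime_gt_1_nat[OF assms(1)]])
  qed
  ultimately have "{i \<in> {1..<K}. p ^ i dvd n} = {1..multiplicity p n}"
    by fastforce
  then show ?thesis by simp
qed

text \<open>Legendre's formula, cut off at \<open>K\<close> because all later quotients are 0. From
  \<open>n\<close> to \<open>Suc n\<close> the quotient by \<open>p ^ i\<close> grows by one exactly
  when \<open>p ^ i\<close> divides \<open>Suc n\<close>.\<close>

lemma multiplicity_fact_eq_sum_div:
  fixes p n :: nat
  assumes "prime p" "n < p ^ K"
  shows "multiplicity p (fact n) = (\<Sum>i\<in>{1..<K}. n div p ^ i)"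
  using assms(2)
proof (induction n)
  case 0
  show ?case by simp
next
  case (Suc n)
  have "multiplicity p (fact (Suc n)) = multiplicity p (Suc n) + multiplicity p (fact n)"
    unfolding fact_Suc of_nat_id
    using assms(1) by (intro prime_elem_multiplicity_mult_distrib) auto
  also have "multiplicity p (Suc n) = (\<Sum>i\<in>{1..<K}. if p ^ i dvd Suc n then 1 else 0)"
    unfolding multiplicity_eq_card_powers[OF assms(1) zero_less_Suc Suc.prems]
    by (subst sum.If_cases) (auto intro!: arg_cong[where f = card])
  also have "multiplicity p (fact n) = (\<Sum>i\<in>{1..<K}. n div p ^ i)"
    using Suc by simp
  also have "(\<Sum>i\<in>{1..<K}. if p ^ i dvd Suc n then 1 else 0) + (\<Sum>i\<in>{1..<K}. n div p ^ i)
    = (\<Sum>i\<in>{1..<K}. Suc n div p ^ i)"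
    unfolding sum.distrib[symmetric]
    by (intro sum.cong refl) (simp add: div_Suc dvd_eq_mod_eq_0)
  finally show ?case .
qed

text \<open>By Legendre's formula each \<open>i\<close> contributes
  \<open>2 * m div p ^ i - 2 * (m div p ^ i)\<close>, which is at most 1, and only those
  \<open>i\<close> with \<open>p ^ i \<le> 2 * m\<close> contribute.\<close>

lemma prime_power_multiplicity_central_binomial_le:
  assumes "prime p" "m > 0"
  shows "p ^ multiplicity p ((2 * m) choose m) \<le> 2 * m"
proof -
  have p1: "p > 1"
    using assms(1) prime_gt_1_nat by simp
  define K where "K = (LEAST K. 2 * m < p ^ K)"
  have ex: "\<exists>K. 2 * m < p ^ K"
    using p1 power_gt_expt[of p "2 * m"] by (auto simp: Suc_le_eq)
  then have K: "2 * m < p ^ K"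
    unfolding K_def by (rule LeastI_ex)
  have K0: "K > 0"
    using K assms(2) by (cases K) auto
  have K1: "p ^ (K - 1) \<le> 2 * m"
    using not_less_Least[of "K - 1" "\<lambda>K. 2 * m < p ^ K"] K0 unfolding K_def[symmetric] by simp
  have "multiplicity p (fact (2 * m) :: nat)
      = multiplicity p (fact m * fact m * ((2 * m) choose m))"
    using binomial_fact_lemma[of m "2 * m"] by (simp add: mult_2)
  also have "\<dots> = 2 * multiplicity p (fact m :: nat) + multiplicity p ((2 * m) choose m)"
    using assms(1) by (simp add: prime_elem_multiplicity_mult_distrib)
  finally have "(\<Sum>i\<in>{1..<K}. (2 * m) div p ^ i)
      = 2 * (\<Sum>i\<in>{1..<K}. m div p ^ i) + multiplicity p ((2 * m) choose m)"
    using multiplicity_fact_eq_sum_div[OF assms(1), of "2 * m" K]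
      multiplicity_fact_eq_sum_div[OF assms(1), of m K] K by simp
  moreover have "(\<Sum>i\<in>{1..<K}. (2 * m) div p ^ i) \<le> (\<Sum>i\<in>{1..<K}. 2 * (m div p ^ i) + 1)"
  proof (rule sum_mono)
    fix i
    have "2 * m < (2 * (m div p ^ i) + 2) * p ^ i"
    proof -
      have "m < (m div p ^ i + 1) * p ^ i"
        using p1 by (simp add: dividend_less_div_times add.commute)
      then show ?thesis by (simp add: algebra_simps)
    qed
    then have "2 * m div p ^ i < 2 * (m div p ^ i) + 2"
      by (simp add: less_mult_imp_div_less)
    then show "2 * m div p ^ i \<le> 2 * (m div p ^ i) + 1" by simp
  qed
  moreover have "(\<Sum>i\<in>{1..<K}. 2 * (m div p ^ i) + 1) = 2 * (\<Sum>i\<in>{1..<K}. m div p ^ i) + (K - 1)"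
    unfolding sum.distrib by (simp add: sum_distrib_left)
  ultimately have "multiplicity p ((2 * m) choose m) \<le> K - 1"
    by linarith
  then have "p ^ multiplicity p ((2 * m) choose m) \<le> p ^ (K - 1)"
    using p1 by (intro power_increasing) auto
  with K1 show ?thesis by simp
qed

text \<open>Chebyshev's argument: the central binomial coefficient is at least \<open>2 ^ m\<close>,
  and it is a product of prime powers that are each at most \<open>2 * m\<close>, one for each of
  its primes.\<close>

lemma two_power_le_power_card_primes:
  assumes "m > 0"
  shows "2 ^ m \<le> (2 * m) ^ card {p. prime p \<and> p \<le> 2 * m}"
proof -
  let ?b = "(2 * m) choose m"
  let ?P = "{p. prime p \<and> p \<le> 2 * m}"
  have fin: "finite ?P"
    by (rule finite_subset[of _ "{..2 * m}"]) auto
  have b0: "?b > 0" by simp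
  have sub: "prime_factors ?b \<subseteq> ?P"
  proof
    fix p assume p: "p \<in> prime_factors ?b"
    then have pr: "prime p" by (rule in_prime_factors_imp_prime)
    have "?b dvd fact (2 * m)"
      using binomial_fact_lemma[of m "2 * m"] by (metis dvd_triv_right le_add2 mult_2)
    then have "p dvd fact (2 * m)"
      using p by (meson dvd_trans in_prime_factors_imp_dvd)
    then show "p \<in> ?P" using pr by (simp add: prime_dvd_fact_iff)
  qed
  have "2 ^ m \<le> ?b"
  proof -
    have "2 ^ m = (\<Sum>k\<le>m. m choose k)" by (simp add: choose_row_sum)
    also have "\<dots> \<le> (\<Sum>k\<le>m. (m choose k)\<^sup>2)"
      by (intro sum_mono) (auto simp: power2_eq_square Suc_le_eq)
    also have "\<dots> = ?b" by (rule choose_square_sum)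
    finally show ?thesis .
  qed
  also have "?b = (\<Prod>p\<in>prime_factors ?b. p ^ multiplicity p ?b)"
    using b0 by (subst prod_prime_factors) auto
  also have "\<dots> \<le> (\<Prod>p\<in>prime_factors ?b. 2 * m)"
    by (intro prod_mono)
      (auto intro!: prime_power_multiplicity_central_binomial_le[OF _ assms])
  also have "\<dots> \<le> (2 * m) ^ card ?P"
    using assms card_mono[OF fin sub] unfolding prod_constant by (intro power_increasing) auto
  finally show ?thesis .
qed

lemma card_primes_up_to_power_of_two_ge:
  assumes "b > 0" "M * b \<le> 2 ^ (b - 1)"
  shows "M \<le> card {p::nat. prime p \<and> p \<le> 2 ^ b}"
proof -
  let ?c = "card {p::nat. prime p \<and> p \<le> 2 ^ b}"
  have "2 * 2 ^ (b - 1) = (2 ^ b :: nat)"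
    using assms(1) by (cases b) auto
  then have "(2::nat) ^ (2 ^ (b - 1)) \<le> (2 ^ b) ^ ?c"
    using two_power_le_power_card_primes[of "2 ^ (b - 1)"] by simp
  then have "2 ^ (b - 1) \<le> b * ?c"
    by (simp flip: power_mult)
  with assms(2) have "M * b \<le> ?c * b" by (metis le_trans mult.commute)
  with assms(1) show ?thesis using mult_le_cancel2[of M b ?c] le_trans by blast
qed

section \<open>Computing the threshold\<close>

lemma computes_Comp1:
  assumes "computes \<phi> Q xs y" "computes \<phi> P [y] z"
  shows "computes \<phi> (Comp P [Q]) xs z"
  using assms by (intro computes.comp[where ys = "[y]"]) auto

definition add_prog :: program where
  "add_prog = PrimRec (Proj 0) (Comp Successor [Proj 1])"

lemma computes_add_prog: "computes \<phi> add_prog [m, n] (m + n)"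
  unfolding add_prog_def
proof (induction m)
  case 0
  have "computes \<phi> (Proj 0) [n] ([n] ! 0)"
    by (rule computes.proj) simp
  then show ?case using computes.primrec_0 by simp
next
  case (Suc m)
  have "computes \<phi> (Proj 1) [m, m + n, n] ([m, m + n, n] ! 1)"
    by (rule computes.proj) simp
  then have "computes \<phi> (Comp Successor [Proj 1]) [m, m + n, n] (Suc (m + n))"
    by (intro computes_Comp1[OF _ computes.successor]) simp
  with Suc show ?case
    using computes.primrec_Suc by fastforce
qed

definition pow2_prog :: program where
  "pow2_prog = Comp (PrimRec (Comp Successor [Zero]) (Comp add_prog [Proj 1, Proj 1])) [Proj 0, Proj 0]"

lemma computes_pow2_prog: "computes \<phi> pow2_prog [n] (2 ^ n)"
proof -
  have proj: "computes \<phi> (Proj i) xs (xs ! i)" if "i < length xs" for i xs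
    using that by (rule computes.proj)
  have "computes \<phi> (PrimRec (Comp Successor [Zero]) (Comp add_prog [Proj 1, Proj 1])) [m, n] (2 ^ m)"
    for m
  proof (induction m)
    case 0
    have "computes \<phi> (Comp Successor [Zero]) [n] 1"
      using computes_Comp1[OF computes.zero computes.successor] by simp
    then show ?case using computes.primrec_0 by simp
  next
    case (Suc m)
    have "computes \<phi> (Comp add_prog [Proj 1, Proj 1]) [m, 2 ^ m, n] (2 ^ m + 2 ^ m)"
      using proj[of 1 "[m, 2 ^ m, n]"]
      by (intro computes.comp[where ys = "[2 ^ m, 2 ^ m]"] computes_add_prog) auto
    with Suc show ?case
      using computes.primrec_Suc by (metis mult_2 power_Suc)
  qed
  then show ?thesis
    unfolding pow2_prog_def using proj[of 0 "[n]"]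
    by (intro computes.comp[where ys = "[n, n]"]) auto
qed

text \<open>Iterated powers of two are easy to program, and only an upper bound for the required
  size is wanted. The height of the tower is what \<open>two_power_le_threshold\<close>
  consumes.\<close>

definition threshold :: "nat \<Rightarrow> nat" where
  "threshold c = 2 ^ 2 ^ 2 ^ 2 ^ (c + 4)"

definition threshold_prog :: program where
  "threshold_prog = Comp pow2_prog [Comp pow2_prog [Comp pow2_prog [Comp pow2_prog
    [Comp Successor [Comp Successor [Comp Successor [Successor]]]]]]]"

lemma computes_threshold_prog: "computes \<phi> threshold_prog [c] (threshold c)"
proof -
  have pow2: "computes \<phi> (Comp pow2_prog [Q]) [c] (2 ^ y)" if "computes \<phi> Q [c] y" for Q y
    using that computes_pow2_prog by (rule computes_Comp1)
  have "computes \<phi> (Comp Successor [Comp Successor [Comp Successor [Successor]]]) [c]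
      (Suc (Suc (Suc (Suc c))))"
    by (intro computes_Comp1[OF _ computes.successor] computes.successor)
  then have "computes \<phi> (Comp Successor [Comp Successor [Comp Successor [Successor]]]) [c] (c + 4)"
    by (simp add: eval_nat_numeral)
  then show ?thesis
    unfolding threshold_prog_def threshold_def by (rule pow2[OF pow2[OF pow2[OF pow2]]])
qed

lemma length_le_list_encode: "length xs \<le> list_encode xs"
proof (induction xs)
  case (Cons x xs)
  then show ?case using le_prod_encode_2[of "list_encode xs" x] by simp
qed simp

lemma mem_le_list_encode: "x \<in> set xs \<Longrightarrow> x \<le> list_encode xs"
proof (induction xs)
  case (Cons y xs)
  then show ?case
    using le_prod_encode_1[of y "list_encode xs"] le_prod_encode_2[of "list_encode xs" y] by auto
qed simp

lemma abs_le_int_encode: "\<bar>i\<bar> \<le> int (int_encode i)"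
  by (simp add: int_encode_def sum_encode_def)

text \<open>Puts every prime of a coefficient below the code of the list, so that adding all primes
  up to the code to \<open>S\<close> takes care of the coefficients.\<close>

lemma quotient_of_le_rat_list_code:
  assumes "q \<in> set a"
  shows "\<bar>fst (quotient_of q)\<bar> \<le> int (rat_list_code a)" "snd (quotient_of q) \<le> int (rat_list_code a)"
proof -
  have "rat_code q \<le> rat_list_code a"
    unfolding rat_list_code_def using assms by (intro mem_le_list_encode) auto
  then show "\<bar>fst (quotient_of q)\<bar> \<le> int (rat_list_code a)" "snd (quotient_of q) \<le> int (rat_list_code a)"
    using abs_le_int_encode[of "fst (quotient_of q)"]
      le_prod_encode_1[of "int_encode (fst (quotient_of q))" "nat (snd (quotient_of q))"]
      le_prod_encode_2[of "nat (snd (quotient_of q))" "int_encode (fst (quotient_of q))"]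
    unfolding rat_code_def by linarith+
qed

section \<open>Smooth numbers\<close>

lemma prime_factors_prod_primes:
  fixes F :: "nat set"
  assumes "finite F" "\<And>p. p \<in> F \<Longrightarrow> prime p"
  shows "prime_factors (\<Prod>F) = F"
  using assms
proof (induction F rule: finite_induct)
  case (insert p F)
  have "0 \<notin> insert p F"
    using insert.prems not_prime_0 by blast
  then have "\<Prod>F \<noteq> 0" "p \<noteq> 0"
    using insert.hyps by auto
  then have "prime_factors (p * \<Prod>F) = prime_factors p \<union> prime_factors (\<Prod>F)"
    by (rule prime_factors_product[rotated])
  then show ?case
    using insert by (simp add: prime_prime_factors)
qed simp

text \<open>The numbers are products of \<open>V\<close> distinct primes of \<open>P\<close>, which
  are determined by their sets of prime factors. There are \<open>card P choose V\<close>, hence at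
  least \<open>(card P / V) ^ V\<close>, of them; exactly \<open>R ^ V\<close> are kept so that
  later cardinalities are pure powers.\<close>

lemma exists_smooth_numbers:
  fixes P :: "nat set"
  assumes "finite P" "\<And>p. p \<in> P \<Longrightarrow> prime p \<and> p \<le> Y" "V > 0" "V * R \<le> card P"
  obtains A :: "int set" where "finite A" "card A = R ^ V"
    "\<And>x. x \<in> A \<Longrightarrow> 0 < x \<and> x \<le> int Y ^ V"
    "\<And>x p. x \<in> A \<Longrightarrow> prime p \<Longrightarrow> int p dvd x \<Longrightarrow> p \<in> P"
proof (cases "R = 0")
  case True
  then show ?thesis using assms(3) by (intro that[of "{}"]) auto
next
  case False
  let ?F = "{F. F \<subseteq> P \<and> card F = V}"
  have F: "finite F" "F \<subseteq> P" "card F = V" "\<And>p. p \<in> F \<Longrightarrow> prime p" if "F \<in> ?F" for F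
    using that assms(1,2) finite_subset by auto
  have finF: "finite ?F"
    using assms(1) by simp
  have inj: "inj_on (\<lambda>F. int (\<Prod>F)) ?F"
  proof (rule inj_onI)
    fix F G assume FG: "F \<in> ?F" "G \<in> ?F" "int (\<Prod>F) = int (\<Prod>G)"
    then have "prime_factors (\<Prod>F) = prime_factors (\<Prod>G)" by (metis of_nat_eq_iff)
    then show "F = G"
      using prime_factors_prod_primes[of F] prime_factors_prod_primes[of G] F[OF FG(1)] F[OF FG(2)]
      by auto
  qed
  have "V \<le> V * R" using False by simp
  then have VP: "V \<le> card P" using assms(4) by linarith
  have "real R ^ V \<le> (real (card P) / real V) ^ V"
  proof (rule power_mono)
    have "real (V * R) \<le> real (card P)" using assms(4) by (rule of_nat_mono)
    then show "real R \<le> real (card P) / real V"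
      using assms(3) by (simp add: field_simps)
  qed simp
  also have "\<dots> \<le> real (card P choose V)"
    using VP by (rule binomial_ge_n_over_k_pow_k)
  finally have "R ^ V \<le> card P choose V"
    by (simp flip: of_nat_power)
  also have "\<dots> = card ((\<lambda>F. int (\<Prod>F)) ` ?F)"
    using inj assms(1) by (simp add: card_image n_subsets)
  finally obtain A where A: "A \<subseteq> (\<lambda>F. int (\<Prod>F)) ` ?F" "card A = R ^ V" "finite A"
    by (rule obtain_subset_with_card_n)
  show ?thesis
  proof (rule that[OF A(3,2)])
    fix x assume "x \<in> A"
    then obtain F where FF: "F \<in> ?F" and x: "x = int (\<Prod>F)" using A(1) by auto
    have "\<Prod>F \<le> (\<Prod>p\<in>F. Y)"
      using F[OF FF] assms(2) by (intro prod_mono) auto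
    then have "\<Prod>F \<le> Y ^ V" using F[OF FF] by simp
    moreover have "\<Prod>F > 0"
      using F[OF FF] by (intro prod_pos) (auto simp: prime_gt_0_nat)
    ultimately show "0 < x \<and> x \<le> int Y ^ V"
      unfolding x by (simp only: of_nat_0_less_iff of_nat_le_iff flip: of_nat_power)
    fix p :: nat assume p: "prime p" "int p dvd x"
    then have "p \<in> prime_factors (\<Prod>F)"
      using \<open>\<Prod>F > 0\<close> unfolding x of_nat_dvd_iff in_prime_factors_iff by simp
    then show "p \<in> P"
      using prime_factors_prod_primes[of F] F[OF FF] by auto
  qed
qed

lemma card_prime_factors_le_log2:
  fixes m :: nat
  assumes "m > 0" "m \<le> 2 ^ l"
  shows "card (prime_factors m) \<le> l"
proof -
  have "2 ^ card (prime_factors m) = (\<Prod>p\<in>prime_factors m. 2 :: nat)"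
    by simp
  also have "\<dots> \<le> (\<Prod>p\<in>prime_factors m. p ^ multiplicity p m)"
  proof (rule prod_mono, rule conjI)
    fix p assume p: "p \<in> prime_factors m"
    then have "p ^ 1 \<le> p ^ multiplicity p m"
      by (intro power_increasing)
        (auto simp: prime_factors_multiplicity Suc_le_eq prime_gt_0_nat)
    moreover have "p \<ge> 2" using p by (auto intro: prime_ge_2_nat)
    ultimately show "2 \<le> p ^ multiplicity p m" by simp
  qed simp
  also have "\<dots> = m"
    using assms(1) by (subst prod_prime_factors) auto
  finally have "(2::nat) ^ card (prime_factors m) \<le> 2 ^ l"
    using assms(2) by linarith
  then show ?thesis by simp
qed

section \<open>Congruences modulo smooth numbers\<close>

text \<open>Pairs of indices are counted, not pairs of values, so different tuples with equal sums
  count separately. The shift \<open>h\<close> is 0 for even \<open>n\<close> and the additional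
  summand for odd \<open>n\<close>.\<close>

definition cong_pairs :: "'a set \<Rightarrow> ('a \<Rightarrow> int) \<Rightarrow> int \<Rightarrow> int \<Rightarrow> ('a \<times> 'a) set" where
  "cong_pairs I g q h = {(i, j) \<in> I \<times> I. q dvd g i - g j + h}"

lemma finite_cong_pairs: "finite I \<Longrightarrow> finite (cong_pairs I g q h)"
  by (rule finite_subset[of _ "I \<times> I"]) (auto simp: cong_pairs_def)

lemma card_cong_pairs_uminus:
  assumes "finite I"
  shows "card (cong_pairs I g q (- h)) = card (cong_pairs I g q h)"
proof -
  have le: "card (cong_pairs I g q h) \<le> card (cong_pairs I g q (- h))" for h
  proof (rule card_inj_on_le[OF inj_swap])
    have swap: "q dvd g j - g i + - h" if "q dvd g i - g j + h" for i j
    proof -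
      have "g j - g i + - h = - (g i - g j + h)" by simp
      with that show ?thesis by (simp only: dvd_minus_iff)
    qed
    show "prod.swap ` cong_pairs I g q h \<subseteq> cong_pairs I g q (- h)"
      using swap by (force simp: cong_pairs_def)
    show "finite (cong_pairs I g q (- h))"
      using assms by (rule finite_cong_pairs)
  qed
  from le[of h] le[of "- h"] show ?thesis by simp
qed

text \<open>Cauchy--Schwarz over the \<open>q\<close> residue classes of \<open>g\<close>: the pairs
  are counted by the sum of the squares of the class sizes.\<close>

lemma card_squared_le_card_cong_pairs:
  assumes "finite I" "q > 0"
  shows "(int (card I))\<^sup>2 \<le> q * int (card (cong_pairs I g q 0))"
proof -
  let ?c = "\<lambda>r. {i \<in> I. g i mod q = r}"
  have "I = (\<Union>r\<in>{0..<q}. ?c r)"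
    using assms(2) by auto
  then have I: "card I = (\<Sum>r\<in>{0..<q}. card (?c r))"
    using card_UN_disjoint[of "{0..<q}" ?c] assms(1) by auto
  have "cong_pairs I g q 0 = (\<Union>r\<in>{0..<q}. ?c r \<times> ?c r)"
    using assms(2) by (auto simp: cong_pairs_def mod_eq_dvd_iff[symmetric])
  also have "card \<dots> = (\<Sum>r\<in>{0..<q}. card (?c r \<times> ?c r))"
    using assms(1) by (intro card_UN_disjoint) auto
  finally have pairs: "card (cong_pairs I g q 0) = (\<Sum>r\<in>{0..<q}. (card (?c r))\<^sup>2)"
    by (simp add: card_cartesian_product power2_eq_square)
  have "(\<Sum>r\<in>{0..<q}. real (card (?c r)))\<^sup>2 \<le> (\<Sum>r\<in>{0..<q}. (real (card (?c r)))\<^sup>2) * card {0..<q}"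
    by (rule sum_squared_le_sum_of_squares)
  then have "(real (card I))\<^sup>2 \<le> real (card (cong_pairs I g q 0)) * real_of_int q"
    unfolding I pairs using assms(2) by simp
  then have "real_of_int ((int (card I))\<^sup>2) \<le> real_of_int (q * int (card (cong_pairs I g q 0)))"
    by (simp add: mult.commute)
  then show ?thesis by (simp only: of_int_le_iff)
qed

text \<open>
  Cauchy--Schwarz applied to the sums \<open>g i + c * h\<close>: if no translate \<open>c * h\<close> of a
  difference \<open>g i - g j\<close> is often divisible by \<open>q\<close>, the difference itself is unusually often.
\<close>

lemma cong_pairs_dichotomy:
  fixes C :: nat
  assumes "finite I" "q > 0" "C > 0"
    and few: "\<And>c. c \<in> {1..<C} \<Longrightarrow> 2 * q * int (card (cong_pairs I g q (int c * h))) < (int (card I))\<^sup>2"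
  shows "int C * (int (card I))\<^sup>2 \<le> 2 * q * int (card (cong_pairs I g q 0))"
proof -
  let ?N = "\<lambda>h. int (card (cong_pairs I g q h))"
  let ?K = "I \<times> {..<C}"
  let ?G = "\<lambda>(i, c). g i + int c * h"
  \<comment> \<open>Only \<open>c - d\<close> matters, and exchanging the two members of a pair
    changes its sign, so the hypothesis for positive multiples covers all off-diagonal
    terms.\<close>
  have few': "2 * q * ?N ((int c - int d) * h) \<le> (int (card I))\<^sup>2" if "c < C" "d < C" "c \<noteq> d" for c d
  proof (cases "d < c")
    case True
    then have "c - d \<in> {1..<C}" using that by auto
    from few[OF this] show ?thesis using True by (simp add: of_nat_diff)
  next
    case False
    then have "?N ((int c - int d) * h) = ?N (int (d - c) * h)"
      using that card_cong_pairs_uminus[OF assms(1), of g q "int (d - c) * h"]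
      by (simp add: of_nat_diff algebra_simps)
    moreover have "d - c \<in> {1..<C}" using that False by auto
    ultimately show ?thesis using few[of "d - c"] by simp
  qed
  have "bij_betw (\<lambda>((c, d), (i, j)). ((i, c), (j, d)))
      (SIGMA (c, d) : {..<C} \<times> {..<C}. cong_pairs I g q ((int c - int d) * h))
      (cong_pairs ?K ?G q 0)"
    by (rule bij_betw_byWitness[where f' = "\<lambda>((i, c), (j, d)). ((c, d), (i, j))"])
      (auto simp: cong_pairs_def algebra_simps)
  then have "card (cong_pairs ?K ?G q 0)
      = card (SIGMA (c, d) : {..<C} \<times> {..<C}. cong_pairs I g q ((int c - int d) * h))"
    using bij_betw_same_card by metis
  also have "\<dots> = (\<Sum>(c, d)\<in>{..<C} \<times> {..<C}. card (cong_pairs I g q ((int c - int d) * h)))"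
    using assms(1) by (subst card_SigmaI) (auto simp: finite_cong_pairs split_def)
  finally have card_K: "int (card (cong_pairs ?K ?G q 0)) = (\<Sum>c<C. \<Sum>d<C. ?N ((int c - int d) * h))"
    by (simp add: sum.cartesian_product split_def)
  have "(int C * int (card I))\<^sup>2 \<le> q * (\<Sum>c<C. \<Sum>d<C. ?N ((int c - int d) * h))"
    using card_squared_le_card_cong_pairs[of ?K q ?G] assms(1,2) card_K
    by (simp add: card_cartesian_product mult.commute)
  then have "2 * (int C * int (card I))\<^sup>2 \<le> (\<Sum>c<C. \<Sum>d<C. 2 * q * ?N ((int c - int d) * h))"
    unfolding mult.assoc sum_distrib_left[symmetric] by simp
  \<comment> \<open>The off-diagonal terms together supply at most half of the lower bound, so the
    \<open>C\<close> equal diagonal terms must supply the other half.\<close>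
  also have "\<dots> \<le> (\<Sum>c<C. \<Sum>d<C. (int (card I))\<^sup>2 + (if c = d then 2 * q * ?N 0 else 0))"
  proof (intro sum_mono)
    fix c d assume "c \<in> {..<C}" "d \<in> {..<C}"
    then show "2 * q * ?N ((int c - int d) * h) \<le> (int (card I))\<^sup>2 + (if c = d then 2 * q * ?N 0 else 0)"
      using few'[of c d] by (cases "c = d") auto
  qed
  also have "\<dots> = int C * (int C * (int (card I))\<^sup>2 + 2 * q * ?N 0)"
    by (simp add: sum.distrib)
  also have "(int C * int (card I))\<^sup>2 = int C * (int C * (int (card I))\<^sup>2)"
    by (simp add: power2_eq_square)
  finally have "int C * (int C * (int (card I))\<^sup>2) \<le> int C * (2 * q * ?N 0)"
    unfolding distrib_left by linarith
  then show ?thesis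
    by (rule mult_left_le_imp_le) (use assms(3) in simp)
qed

section \<open>Vanishing subsums\<close>

text \<open>One encoding for both parities: the sum \<open>x\<^sub>1 + \<dots> + x\<^sub>k -
  y\<^sub>1 - \<dots> - y\<^sub>k\<close>, followed at index \<open>2 * k\<close> by the additional
  summand, which is read only when \<open>n\<close> is odd.\<close>

definition signed_tuple :: "nat \<Rightarrow> (nat \<Rightarrow> int) \<Rightarrow> (nat \<Rightarrow> int) \<Rightarrow> int \<Rightarrow> nat \<Rightarrow> int" where
  "signed_tuple k f f' \<tau> j = (if j < k then f j else if j < 2 * k then - f' (j - k) else \<tau>)"

lemma sum_signed_tuple:
  assumes "J \<subseteq> {..<Suc (2 * k)}"
  shows "(\<Sum>j\<in>J. signed_tuple k f f' \<tau> j)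
    = (\<Sum>j\<in>{j. j < k \<and> j \<in> J}. f j) - (\<Sum>j\<in>{j. j < k \<and> j + k \<in> J}. f' j)
      + (if 2 * k \<in> J then \<tau> else 0)"
proof -
  have fin: "finite J" using assms finite_subset by blast
  have J: "J = {j. j < k \<and> j \<in> J} \<union> ({j \<in> J. k \<le> j \<and> j < 2 * k} \<union> {j \<in> J. j = 2 * k})"
    using assms by auto
  have "(\<Sum>j\<in>J. signed_tuple k f f' \<tau> j) = (\<Sum>j\<in>{j. j < k \<and> j \<in> J}. signed_tuple k f f' \<tau> j)
     + ((\<Sum>j\<in>{j \<in> J. k \<le> j \<and> j < 2 * k}. signed_tuple k f f' \<tau> j)
     + (\<Sum>j\<in>{j \<in> J. j = 2 * k}. signed_tuple k f f' \<tau> j))"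
    unfolding arg_cong[OF J, of "sum (signed_tuple k f f' \<tau>)"]
    using fin by (subst sum.union_disjoint, simp, simp, force, subst sum.union_disjoint) auto
  also have "(\<Sum>j\<in>{j. j < k \<and> j \<in> J}. signed_tuple k f f' \<tau> j) = (\<Sum>j\<in>{j. j < k \<and> j \<in> J}. f j)"
    by (intro sum.cong) (auto simp: signed_tuple_def)
  also have "(\<Sum>j\<in>{j \<in> J. k \<le> j \<and> j < 2 * k}. signed_tuple k f f' \<tau> j)
      = (\<Sum>j\<in>{j. j < k \<and> j + k \<in> J}. - f' j)"
    by (rule sum.reindex_bij_witness[where i = "\<lambda>j. j + k" and j = "\<lambda>j. j - k"])
      (auto simp: signed_tuple_def)
  also have "(\<Sum>j\<in>{j \<in> J. j = 2 * k}. signed_tuple k f f' \<tau> j) = (if 2 * k \<in> J then \<tau> else 0)"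
  proof -
    have "{j \<in> J. j = 2 * k} = (if 2 * k \<in> J then {2 * k} else {})" by auto
    then show ?thesis by (simp add: signed_tuple_def)
  qed
  finally show ?thesis by (simp add: sum_negf)
qed

text \<open>For any \<open>i\<close> in \<open>J\<close>, the prescribed sum determines
  \<open>f i\<close> from the other \<open>k - 1\<close> values.\<close>

lemma card_PiE_sum_eq_le:
  fixes A :: "int set"
  assumes "finite A" "J \<subseteq> {..<k}" "J \<noteq> {}"
  shows "card {f \<in> {..<k} \<rightarrow>\<^sub>E A. (\<Sum>j\<in>J. f j) = v} \<le> card A ^ (k - 1)"
proof -
  obtain i where i: "i \<in> J" using assms(3) by auto
  have finJ: "finite J" using assms(2) finite_subset by blast
  let ?S = "{f \<in> {..<k} \<rightarrow>\<^sub>E A. (\<Sum>j\<in>J. f j) = v}"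
  let ?r = "\<lambda>f. restrict f ({..<k} - {i})"
  have "inj_on ?r ?S"
  proof (rule inj_onI)
    fix f f' assume f: "f \<in> ?S" and f': "f' \<in> ?S" and eq: "?r f = ?r f'"
    have ne: "f j = f' j" if "j \<in> {..<k} - {i}" for j
      using fun_cong[OF eq, of j] that by simp
    have "f i + (\<Sum>j\<in>J - {i}. f j) = f' i + (\<Sum>j\<in>J - {i}. f' j)"
      using f f' sum.remove[OF finJ i, of f] sum.remove[OF finJ i, of f'] by simp
    moreover have "(\<Sum>j\<in>J - {i}. f j) = (\<Sum>j\<in>J - {i}. f' j)"
      using assms(2) by (intro sum.cong ne) auto
    ultimately have "f i = f' i" by simp
    with ne have "f j = f' j" if "j \<in> {..<k}" for j
      using that by (cases "j = i") auto
    with f f' show "f = f'"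
      by (intro PiE_ext[of f "{..<k}" "\<lambda>_. A"]) auto
  qed
  moreover have "?r ` ?S \<subseteq> ({..<k} - {i}) \<rightarrow>\<^sub>E A"
    by (rule image_subsetI) (auto simp: Pi_def PiE_mem)
  ultimately have "card ?S \<le> card (({..<k} - {i}) \<rightarrow>\<^sub>E A)"
    by (rule card_inj_on_le) (simp add: assms(1) finite_PiE)
  also have "\<dots> = card A ^ (k - 1)"
    using i assms(2) by (subst card_PiE) auto
  finally show ?thesis .
qed

lemma card_pairs_diff_eq_le_right:
  fixes a b :: "'a \<Rightarrow> int"
  assumes "finite I" "\<And>v. card {y \<in> I. b y = v} \<le> m"
  shows "card {(x, y) \<in> I \<times> I. a x - b y + t = 0} \<le> card I * m"
proof -
  have "{(x, y) \<in> I \<times> I. a x - b y + t = 0} = (SIGMA x : I. {y \<in> I. b y = a x + t})"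
    by auto
  then have "card {(x, y) \<in> I \<times> I. a x - b y + t = 0} = (\<Sum>x\<in>I. card {y \<in> I. b y = a x + t})"
    using assms(1) by simp
  also have "\<dots> \<le> (\<Sum>x\<in>I. m)"
    by (intro sum_mono assms(2))
  finally show ?thesis by simp
qed

lemma card_pairs_diff_eq_le_left:
  fixes a b :: "'a \<Rightarrow> int"
  assumes "finite I" "\<And>v. card {x \<in> I. a x = v} \<le> m"
  shows "card {(x, y) \<in> I \<times> I. a x - b y + t = 0} \<le> card I * m"
proof -
  have "card {(x, y) \<in> I \<times> I. a x - b y + t = 0} \<le> card {(y, x) \<in> I \<times> I. b y - a x + - t = 0}"
    using assms(1) by (intro card_inj_on_le[OF inj_swap]) (auto intro: finite_subset[of _ "I \<times> I"])
  also have "\<dots> \<le> card I * m"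
    using assms by (rule card_pairs_diff_eq_le_right)
  finally show ?thesis .
qed

text \<open>The full index set is included among the \<open>J\<close>, beyond what degeneracy asks
  for: discarding these pairs also makes the total, and with it the cofactor, nonzero.\<close>

definition vanishing_pairs :: "nat \<Rightarrow> nat \<Rightarrow> int set \<Rightarrow> int \<Rightarrow> ((nat \<Rightarrow> int) \<times> (nat \<Rightarrow> int)) set" where
  "vanishing_pairs n k A \<tau> = {(f, f') \<in> ({..<k} \<rightarrow>\<^sub>E A) \<times> ({..<k} \<rightarrow>\<^sub>E A).
     \<exists>J \<subseteq> {..<n}. J \<noteq> {} \<and> (\<Sum>j\<in>J. signed_tuple k f f' \<tau> j) = 0}"

text \<open>A set \<open>J\<close> meeting one of the two blocks of \<open>k\<close> indices fixes
  one of the \<open>2 * k\<close> free values. The only other nonempty \<open>J\<close> is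
  \<open>{2 * k}\<close>, whose sum \<open>\<tau>\<close> is nonzero. The union over all
  \<open>J\<close> costs \<open>2 ^ n\<close>.\<close>

lemma card_vanishing_pairs_le:
  assumes "finite A" "k > 0" "n = 2 * k \<or> n = Suc (2 * k) \<and> \<tau> \<noteq> 0"
  shows "card (vanishing_pairs n k A \<tau>) \<le> 2 ^ n * card A ^ (2 * k - 1)"
proof -
  let ?I = "{..<k} \<rightarrow>\<^sub>E A"
  let ?W = "\<lambda>J. {(f, f') \<in> ?I \<times> ?I. (\<Sum>j\<in>J. signed_tuple k f f' \<tau> j) = 0}"
  have finI: "finite ?I" using assms(1) by (auto intro: finite_PiE)
  have cardI: "card ?I = card A ^ k" by (simp add: card_PiE)
  have W: "card (?W J) \<le> card A ^ (2 * k - 1)" if J: "J \<subseteq> {..<n}" "J \<noteq> {}" for J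
  proof -
    let ?J1 = "{j. j < k \<and> j \<in> J}" and ?J2 = "{j. j < k \<and> j + k \<in> J}"
    define s where "s J f = (\<Sum>j\<in>J. f j)" for J :: "nat set" and f :: "nat \<Rightarrow> int"
    define t where "t = (if 2 * k \<in> J then \<tau> else 0)"
    have "J \<subseteq> {..<Suc (2 * k)}"
      using J(1) assms(3) by auto
    then have sum: "(\<Sum>j\<in>J. signed_tuple k f f' \<tau> j) = s ?J1 f - s ?J2 f' + t" for f f'
      unfolding s_def t_def by (rule sum_signed_tuple)
    have card_s: "card {f \<in> ?I. s J' f = v} \<le> card A ^ (k - 1)" if "J' \<subseteq> {..<k}" "J' \<noteq> {}" for J' v
      using card_PiE_sum_eq_le[OF assms(1) that] unfolding s_def .
    have pw: "card A ^ k * card A ^ (k - 1) = card A ^ (2 * k - 1)"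
      using assms(2) by (simp add: mult_2 flip: power_add)
    show ?thesis
    proof (cases "?J1 = {}")
      case False
      have "card (?W J) \<le> card ?I * card A ^ (k - 1)"
        unfolding sum using False by (intro card_pairs_diff_eq_le_left finI card_s) auto
      then show ?thesis unfolding cardI pw .
    next
      case J1: True
      show ?thesis
      proof (cases "?J2 = {}")
        case False
        have "card (?W J) \<le> card ?I * card A ^ (k - 1)"
          unfolding sum using False by (intro card_pairs_diff_eq_le_right finI card_s) auto
        then show ?thesis unfolding cardI pw .
      next
        case J2: True
        obtain j where j: "j \<in> J" using J(2) by auto
        have "\<not> j < k" using J1 j by auto
        moreover have "\<not> (k \<le> j \<and> j < 2 * k)"
        proof
          assume "k \<le> j \<and> j < 2 * k"
          then have "j - k \<in> ?J2" using j by auto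
          then show False using J2 by blast
        qed
        ultimately have "n = Suc (2 * k)" "2 * k \<in> J" "\<tau> \<noteq> 0"
          using j J(1) assms(3) less_antisym by fastforce+
        then have "?W J = {}" unfolding sum J1 J2 by (auto simp: s_def t_def)
        then show ?thesis by (simp only: card.empty)
      qed
    qed
  qed
  have "vanishing_pairs n k A \<tau> = (\<Union>J\<in>{J. J \<subseteq> {..<n} \<and> J \<noteq> {}}. ?W J)"
    unfolding vanishing_pairs_def by auto
  also have "card \<dots> \<le> (\<Sum>J\<in>{J. J \<subseteq> {..<n} \<and> J \<noteq> {}}. card (?W J))"
    by (intro card_UN_le) simp
  also have "\<dots> \<le> (\<Sum>J\<in>{J. J \<subseteq> {..<n} \<and> J \<noteq> {}}. card A ^ (2 * k - 1))"
    using W by (intro sum_mono) blast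
  also have "\<dots> \<le> (\<Sum>J\<in>Pow {..<n}. card A ^ (2 * k - 1))"
    by (intro sum_mono2) auto
  also have "\<dots> = 2 ^ n * card A ^ (2 * k - 1)"
    by (simp add: card_Pow)
  finally show ?thesis .
qed

section \<open>Popular multiples\<close>

lemma sum_signed_tuple_lessThan:
  assumes "n = 2 * k \<and> \<tau> = 0 \<or> n = Suc (2 * k)"
  shows "(\<Sum>j<n. signed_tuple k f f' \<tau> j) = (\<Sum>j<k. f j) - (\<Sum>j<k. f' j) + \<tau>"
proof -
  have "{j. j < k \<and> j \<in> {..<n}} = {..<k}" "{j. j < k \<and> j + k \<in> {..<n}} = {..<k}"
    using assms by auto
  moreover have "{..<n} \<subseteq> {..<Suc (2 * k)}"
    using assms by auto
  ultimately show ?thesis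
    using assms sum_signed_tuple[of "{..<n}" k f f' \<tau>] by auto
qed

lemma abs_sum_signed_tuple_le:
  assumes "f \<in> {..<k} \<rightarrow>\<^sub>E A" "f' \<in> {..<k} \<rightarrow>\<^sub>E A" "\<And>x. x \<in> A \<Longrightarrow> \<bar>x\<bar> \<le> X" "\<bar>\<tau>\<bar> \<le> X"
  shows "\<bar>\<Sum>j<n. signed_tuple k f f' \<tau> j\<bar> \<le> int n * X"
proof -
  have "\<bar>signed_tuple k f f' \<tau> j\<bar> \<le> X" for j
    using assms(3,4) PiE_mem[OF assms(1), of j] PiE_mem[OF assms(2), of "j - k"]
    by (auto simp: signed_tuple_def)
  then have "(\<Sum>j<n. \<bar>signed_tuple k f f' \<tau> j\<bar>) \<le> (\<Sum>j<n. X)"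
    by (intro sum_mono)
  then show ?thesis
    by (intro order_trans[OF sum_abs]) simp
qed

lemma signed_tuple_inject:
  assumes f: "f \<in> {..<k} \<rightarrow>\<^sub>E A" "f' \<in> {..<k} \<rightarrow>\<^sub>E A" "e \<in> {..<k} \<rightarrow>\<^sub>E A" "e' \<in> {..<k} \<rightarrow>\<^sub>E A"
    and n: "n = 2 * k \<and> \<tau> = \<sigma> \<or> n = Suc (2 * k)"
    and eq: "\<And>j. j < n \<Longrightarrow> signed_tuple k f f' \<tau> j = signed_tuple k e e' \<sigma> j"
  shows "f = e \<and> f' = e' \<and> \<tau> = \<sigma>"
proof (intro conjI)
  show "f = e"
  proof (rule PiE_ext[OF f(1,3)])
    fix j assume "j \<in> {..<k}"
    then show "f j = e j" using eq[of j] n by (auto simp: signed_tuple_def)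
  qed
  show "f' = e'"
  proof (rule PiE_ext[OF f(2,4)])
    fix j assume "j \<in> {..<k}"
    then show "f' j = e' j" using eq[of "j + k"] n by (auto simp: signed_tuple_def)
  qed
  show "\<tau> = \<sigma>"
    using n eq[of "2 * k"] by (auto simp: signed_tuple_def)
qed

text \<open>The hypotheses give at least \<open>2 ^ (m + 1)\<close> congruent pairs, while a
  vanishing subsum occurs for at most \<open>2 ^ m\<close> pairs because \<open>card A\<close>
  exceeds \<open>q\<close> by enough. Half of the pairs remain. The exponent \<open>e\<close> is the
  surplus over Cauchy--Schwarz, positive only in the second alternative for odd
  \<open>n\<close>.\<close>

lemma card_nonvanishing_cong_pairs_ge:
  fixes A :: "int set"
  assumes A: "finite A" "card A = 2 ^ \<alpha>" and k: "k > 0"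
    and n: "n = 2 * k \<or> n = Suc (2 * k) \<and> \<tau> \<noteq> 0"
    and q: "q < 2 ^ (j + 1)" and \<alpha>: "j + n + 3 \<le> \<alpha>"
    and many: "2 ^ (2 * \<alpha> * k + e) \<le> 2 * q * int (card (cong_pairs ({..<k} \<rightarrow>\<^sub>E A) g q \<tau>))"
  shows "2 ^ (2 * \<alpha> * k + e - (j + 3))
    \<le> card (cong_pairs ({..<k} \<rightarrow>\<^sub>E A) g q \<tau> - vanishing_pairs n k A \<tau>)"
proof -
  let ?N = "cong_pairs ({..<k} \<rightarrow>\<^sub>E A) g q \<tau>"
  let ?V = "vanishing_pairs n k A \<tau>"
  define m where "m = 2 * \<alpha> * k + e - (j + 3)"
  have ak: "\<alpha> \<le> 2 * \<alpha> * k" using k by (cases k) auto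
  have m: "2 * \<alpha> * k + e = (j + 2) + (m + 1)"
    using ak \<alpha> unfolding m_def by linarith
  have "2 ^ (j + 2) * 2 ^ (m + 1) \<le> 2 * q * int (card ?N)"
    using many unfolding m power_add .
  also have "\<dots> \<le> 2 ^ (j + 2) * int (card ?N)"
    using q by (intro mult_right_mono) simp_all
  finally have "(2::int) ^ (m + 1) \<le> int (card ?N)"
    by (rule mult_left_le_imp_le) simp
  then have N: "2 ^ (m + 1) \<le> card ?N"
    by (metis of_nat_le_iff of_nat_numeral of_nat_power)
  have "card ?V \<le> 2 ^ n * (2 ^ \<alpha>) ^ (2 * k - 1)"
    using card_vanishing_pairs_le[OF A(1) k n] A(2) by simp
  also have "\<dots> = 2 ^ (n + \<alpha> * (2 * k - 1))"
    by (simp add: power_add flip: power_mult)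
  also have "\<dots> \<le> 2 ^ m"
  proof (rule power_increasing)
    have "\<alpha> * (2 * k - 1) + \<alpha> = 2 * \<alpha> * k"
      using k by (cases k) (auto simp: algebra_simps)
    then show "n + \<alpha> * (2 * k - 1) \<le> m" using m \<alpha> by linarith
  qed simp
  finally have V: "card ?V \<le> 2 ^ m" .
  have "finite ?V"
    unfolding vanishing_pairs_def
    by (rule finite_subset[of _ "({..<k} \<rightarrow>\<^sub>E A) \<times> ({..<k} \<rightarrow>\<^sub>E A)"]) (use A(1) in \<open>auto intro: finite_PiE\<close>)
  then have "card ?N - card ?V \<le> card (?N - ?V)"
    by (rule diff_card_le_card_Diff)
  with N V show ?thesis unfolding m_def[symmetric] by simp
qed

text \<open>Pigeonhole on the key consisting of the multiplier \<open>c\<close> and the cofactor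
  \<open>r\<close>; both have to be common to all equations, since the primes of both are put into
  \<open>S\<close>. \<open>H q\<close> lists the admissible additional summands
  \<open>\<tau>\<close> with their multipliers, and \<open>M\<close> times the number of keys is at
  most the number of nonvanishing configurations.\<close>

lemma exists_popular_multiple:
  fixes A Q :: "int set" and H :: "int \<Rightarrow> (nat \<times> int) set"
  assumes A: "finite A" "card A = 2 ^ \<alpha>" "\<And>x. x \<in> A \<Longrightarrow> 0 < x \<and> x \<le> 2 ^ \<xi>"
    and k: "k > 0" and n: "n = 2 * k \<or> n = Suc (2 * k)"
    and Q: "finite Q" "\<And>q. q \<in> Q \<Longrightarrow> 2 ^ j \<le> q \<and> q < 2 ^ (j + 1)"
    and j: "j \<le> \<xi>" "j + n + 3 \<le> \<alpha>"
    and H: "\<And>q. q \<in> Q \<Longrightarrow> finite (H q) \<and> h\<^sub>0 \<le> card (H q)"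
    and H': "\<And>q c \<tau>. q \<in> Q \<Longrightarrow> (c, \<tau>) \<in> H q \<Longrightarrow> c \<in> C \<and> \<bar>\<tau>\<bar> \<le> 2 ^ \<xi> \<and> (n = Suc (2 * k) \<longleftrightarrow> \<tau> \<noteq> 0)
      \<and> 2 ^ (2 * \<alpha> * k + e) \<le> 2 * q * int (card (cong_pairs ({..<k} \<rightarrow>\<^sub>E A) (\<lambda>f. \<Sum>i<k. f i) q \<tau>))"
    and C: "finite C" "C \<noteq> {}"
    and M: "M * (card C * (2 * n * 2 ^ (\<xi> - j))) \<le> card Q * (h\<^sub>0 * 2 ^ (2 * \<alpha> * k + e - (j + 3)))"
  shows "\<exists>c\<in>C. \<exists>r. r \<noteq> 0 \<and> \<bar>r\<bar> \<le> int n * 2 ^ \<xi> \<and> (\<exists>D. finite D \<and> M \<le> card D \<and>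
    (\<forall>(q, w)\<in>D. q \<in> Q \<and> (\<exists>\<tau> f f'. (c, \<tau>) \<in> H q \<and> f \<in> {..<k} \<rightarrow>\<^sub>E A \<and> f' \<in> {..<k} \<rightarrow>\<^sub>E A \<and>
      w = map (signed_tuple k f f' \<tau>) [0..<n] \<and> (\<Sum>j<n. signed_tuple k f f' \<tau> j) = q * r \<and>
      (\<forall>J\<subseteq>{..<n}. J \<noteq> {} \<longrightarrow> (\<Sum>j\<in>J. signed_tuple k f f' \<tau> j) \<noteq> 0))))"
proof -
  let ?I = "{..<k} \<rightarrow>\<^sub>E A"
  define g :: "(nat \<Rightarrow> int) \<Rightarrow> int" where "g f = (\<Sum>i<k. f i)" for f
  define P where "P q \<tau> = cong_pairs ?I g q \<tau> - vanishing_pairs n k A \<tau>" for q \<tau>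
  define T where "T = (SIGMA q : Q. SIGMA h : H q. P q (snd h))"
  define total where "total \<tau> p = (\<Sum>j<n. signed_tuple k (fst p) (snd p) \<tau> j)" for \<tau> p
  define key where "key = (\<lambda>(q, (c, \<tau>), p). (c :: nat, total \<tau> p div q))"
  define R where "R = {- (int n * 2 ^ (\<xi> - j))..int n * 2 ^ (\<xi> - j)} - {0 :: int}"
  have n0: "n > 0" using n k by auto
  have finP: "finite (P q \<tau>)" for q \<tau>
    unfolding P_def using A(1) by (intro finite_Diff finite_cong_pairs finite_PiE) auto
  have finT: "finite T"
    unfolding T_def using Q(1) H finP by (intro finite_SigmaI) auto
  have T: "q \<in> Q" "(c, \<tau>) \<in> H q" "f \<in> ?I" "f' \<in> ?I" "total \<tau> (f, f') = q * (total \<tau> (f, f') div q)"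
      "\<And>J. J \<subseteq> {..<n} \<Longrightarrow> J \<noteq> {} \<Longrightarrow> (\<Sum>j\<in>J. signed_tuple k f f' \<tau> j) \<noteq> 0"
      "total \<tau> (f, f') div q \<in> R" "c \<in> C"
    if "(q, (c, \<tau>), (f, f')) \<in> T" for q c \<tau> f f'
  proof -
    show *: "q \<in> Q" "(c, \<tau>) \<in> H q" "f \<in> ?I" "f' \<in> ?I"
      using that unfolding T_def P_def cong_pairs_def by auto
    show "c \<in> C" using H'[OF *(1,2)] by simp
    have dvd: "q dvd g f - g f' + \<tau>"
      using that unfolding T_def P_def cong_pairs_def by auto
    have tot: "total \<tau> (f, f') = g f - g f' + \<tau>"
      unfolding total_def g_def fst_conv snd_conv
      using n H'[OF *(1,2)] by (intro sum_signed_tuple_lessThan) auto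
    show eq: "total \<tau> (f, f') = q * (total \<tau> (f, f') div q)"
      using dvd unfolding tot by simp
    show nv: "(\<Sum>j\<in>J. signed_tuple k f f' \<tau> j) \<noteq> 0" if "J \<subseteq> {..<n}" "J \<noteq> {}" for J
      using \<open>(q, (c, \<tau>), (f, f')) \<in> T\<close> *(3,4) that unfolding T_def P_def vanishing_pairs_def by auto
    have "total \<tau> (f, f') \<noteq> 0"
      unfolding total_def using nv[of "{..<n}"] n0 by auto
    then have r0: "total \<tau> (f, f') div q \<noteq> 0"
      using eq by auto
    have "\<bar>total \<tau> (f, f')\<bar> \<le> int n * 2 ^ \<xi>"
      unfolding total_def fst_conv snd_conv
      by (rule abs_sum_signed_tuple_le[OF *(3,4)]) (use A(3) H'[OF *(1,2)] in \<open>auto simp: abs_le_iff less_imp_le\<close>)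
    then have "q * \<bar>total \<tau> (f, f') div q\<bar> \<le> int n * 2 ^ \<xi>"
      using eq Q(2)[OF *(1)] by (metis abs_mult abs_of_nonneg order_trans zero_le_numeral zero_le_power)
    moreover have "2 ^ j * \<bar>total \<tau> (f, f') div q\<bar> \<le> q * \<bar>total \<tau> (f, f') div q\<bar>"
      using Q(2)[OF *(1)] by (intro mult_right_mono) auto
    moreover have "int n * 2 ^ \<xi> = 2 ^ j * (int n * 2 ^ (\<xi> - j))"
      using j(1) by (simp flip: power_add)
    ultimately have "2 ^ j * \<bar>total \<tau> (f, f') div q\<bar> \<le> 2 ^ j * (int n * 2 ^ (\<xi> - j))"
      by linarith
    then have "\<bar>total \<tau> (f, f') div q\<bar> \<le> int n * 2 ^ (\<xi> - j)"
      by (rule mult_left_le_imp_le) simp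
    then show "total \<tau> (f, f') div q \<in> R"
      using r0 unfolding R_def by auto
  qed
  have cardR: "card R = 2 * n * 2 ^ (\<xi> - j)"
    unfolding R_def by (subst card_Diff_singleton) (auto simp: nat_add_distrib nat_mult_distrib nat_power_eq)
  have finR: "finite R" unfolding R_def by simp
  have R0: "R \<noteq> {}" using cardR n0 by auto
  have "M * card (C \<times> R) \<le> card Q * (h\<^sub>0 * 2 ^ (2 * \<alpha> * k + e - (j + 3)))"
    using M cardR by (simp add: card_cartesian_product)
  also have "\<dots> = (\<Sum>q\<in>Q. h\<^sub>0 * 2 ^ (2 * \<alpha> * k + e - (j + 3)))"
    by simp
  also have "\<dots> \<le> (\<Sum>q\<in>Q. \<Sum>h\<in>H q. card (P q (snd h)))"
  proof (rule sum_mono)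
    fix q assume q: "q \<in> Q"
    have "2 ^ (2 * \<alpha> * k + e - (j + 3)) \<le> card (P q (snd h))" if "h \<in> H q" for h
    proof -
      obtain c \<tau> where h: "h = (c, \<tau>)" by (cases h)
      show ?thesis
        unfolding h snd_conv P_def using Q(2)[OF q] H'[OF q, of c \<tau>] that n unfolding h g_def
        by (intro card_nonvanishing_cong_pairs_ge A k j) auto
    qed
    then have "card (H q) * 2 ^ (2 * \<alpha> * k + e - (j + 3)) \<le> (\<Sum>h\<in>H q. card (P q (snd h)))"
      using sum_mono[of "H q" "\<lambda>_. 2 ^ (2 * \<alpha> * k + e - (j + 3))" "\<lambda>h. card (P q (snd h))"] by simp
    moreover have "h\<^sub>0 * 2 ^ (2 * \<alpha> * k + e - (j + 3)) \<le> card (H q) * 2 ^ (2 * \<alpha> * k + e - (j + 3))"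
      using H[OF q] by (intro mult_right_mono) auto
    ultimately show "h\<^sub>0 * 2 ^ (2 * \<alpha> * k + e - (j + 3)) \<le> (\<Sum>h\<in>H q. card (P q (snd h)))"
      by linarith
  qed
  also have "\<dots> = card T"
    unfolding T_def using Q(1) H finP by simp
  finally have MT: "M * card (C \<times> R) \<le> card T" .
  have "key \<in> T \<rightarrow> C \<times> R"
    unfolding key_def using T(7,8) by auto
  then obtain y where y: "y \<in> C \<times> R" "card T \<le> card (key -` {y} \<inter> T) * card (C \<times> R)"
    using pigeonhole_card[OF _ finT, of key "C \<times> R"] C R0 finR by auto
  obtain c r where cr: "y = (c, r)" "c \<in> C" "r \<in> R"
    using y(1) by auto
  define F where "F = key -` {y} \<inter> T"
  define out where "out = (\<lambda>(q :: int, (c :: nat, \<tau>), p). (q, map (signed_tuple k (fst p) (snd p) \<tau>) [0..<n]))"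
  have MF: "M \<le> card F"
  proof -
    have "M * card (C \<times> R) \<le> card F * card (C \<times> R)"
      using MT y(2) unfolding F_def by linarith
    moreover have "card (C \<times> R) > 0"
      using C R0 finR by (auto simp: card_gt_0_iff)
    ultimately show ?thesis by simp
  qed
  have F: "(q, (d, \<tau>), (f, f')) \<in> T \<and> d = c \<and> total \<tau> (f, f') div q = r"
    if "(q, (d, \<tau>), (f, f')) \<in> F" for q d \<tau> f f'
    using that unfolding F_def key_def cr by auto
  \<comment> \<open>\<open>out\<close> forgets the multiplier, which is constant on
    \<open>F\<close>, and \<open>\<tau>\<close>, which is the last entry for odd \<open>n\<close>
    and 0 for even \<open>n\<close>.\<close>
  have inj: "inj_on out F"
  proof (rule inj_onI)
    fix s t assume s: "s \<in> F" and t: "t \<in> F" and eq: "out s = out t"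
    obtain q d \<tau> f f' where s': "s = (q, (d, \<tau>), (f, f'))" by (metis surj_pair)
    obtain q' d' \<sigma> e e' where t': "t = (q', (d', \<sigma>), (e, e'))" by (metis surj_pair)
    note sT = F[OF s[unfolded s'], THEN conjunct1] and tT = F[OF t[unfolded t'], THEN conjunct1]
    have qq: "q = q'" and w: "signed_tuple k f f' \<tau> j = signed_tuple k e e' \<sigma> j" if "j < n" for j
      using eq that unfolding out_def s' t' by auto
    have "n = 2 * k \<and> \<tau> = \<sigma> \<or> n = Suc (2 * k)"
      using n H'[OF T(1,2)[OF sT]] H'[OF T(1,2)[OF tT]] by auto
    then have "f = e \<and> f' = e' \<and> \<tau> = \<sigma>"
      by (rule signed_tuple_inject[OF T(3,4)[OF sT] T(3,4)[OF tT]]) (rule w)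
    then show "s = t"
      using qq[OF n0] F[OF s[unfolded s']] F[OF t[unfolded t']] unfolding s' t' by auto
  qed
  have r: "r \<noteq> 0" "\<bar>r\<bar> \<le> int n * 2 ^ \<xi>"
  proof -
    show "r \<noteq> 0" using cr(3) unfolding R_def by auto
    have "int n * 2 ^ (\<xi> - j) \<le> int n * 2 ^ \<xi>"
      by (intro mult_left_mono power_increasing) auto
    then show "\<bar>r\<bar> \<le> int n * 2 ^ \<xi>" using cr(3) unfolding R_def by auto
  qed
  show ?thesis
  proof (intro bexI[OF _ cr(2)] exI[of _ r] conjI r exI[of _ "out ` F"] ballI)
    show "finite (out ` F)" unfolding F_def using finT by auto
    show "M \<le> card (out ` F)" using MF inj by (simp add: card_image)
    fix x assume "x \<in> out ` F"
    then obtain s where s: "s \<in> F" "x = out s" by auto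
    obtain q d \<tau> f f' where s': "s = (q, (d, \<tau>), (f, f'))" by (metis surj_pair)
    note sF = F[OF s(1)[unfolded s']]
    note sT = sF[THEN conjunct1]
    have x: "x = (q, map (signed_tuple k f f' \<tau>) [0..<n])"
      unfolding s(2) s' out_def by simp
    show "case x of (q, w) \<Rightarrow> q \<in> Q \<and> (\<exists>\<tau> f f'. (c, \<tau>) \<in> H q \<and> f \<in> ?I \<and> f' \<in> ?I \<and>
      w = map (signed_tuple k f f' \<tau>) [0..<n] \<and> (\<Sum>j<n. signed_tuple k f f' \<tau> j) = q * r \<and>
      (\<forall>J\<subseteq>{..<n}. J \<noteq> {} \<longrightarrow> (\<Sum>j\<in>J. signed_tuple k f f' \<tau> j) \<noteq> 0))"
      unfolding x prod.case
    proof (intro conjI[OF _ exI[of _ \<tau>, OF exI[of _ f, OF exI[of _ f']]]] conjI allI impI)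
      show "q \<in> Q" "(c, \<tau>) \<in> H q" "f \<in> ?I" "f' \<in> ?I"
        using T(1-4)[OF sT] sF by auto
      show "(\<Sum>j<n. signed_tuple k f f' \<tau> j) = q * r"
        using T(5)[OF sT] sF unfolding total_def by simp
      show "(\<Sum>j\<in>J. signed_tuple k f f' \<tau> j) \<noteq> 0" if "J \<subseteq> {..<n}" "J \<noteq> {}" for J
        using T(6)[OF sT that] .
    qed simp
  qed
qed

section \<open>From multiples to solutions in S-units\<close>

text \<open>Reduction to lowest terms introduces no primes: the reduced numerator divides
  \<open>u\<close> and the reduced denominator divides \<open>v\<close>.\<close>

lemma S_unit_divide:
  assumes "u \<noteq> 0" "v \<noteq> 0"
    and "\<And>p::nat. prime p \<Longrightarrow> int p dvd u \<or> int p dvd v \<Longrightarrow> p \<in> S"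
  shows "S_unit S (of_int u / of_int v)"
proof -
  let ?x = "of_int u / of_int v :: rat"
  obtain m d where md: "quotient_of ?x = (m, d)" by (cases "quotient_of ?x")
  have d: "d > 0" using quotient_of_denom_pos[OF md] .
  have cop: "coprime m d" using quotient_of_coprime[OF md] .
  have "(of_int u / of_int v :: rat) = of_int m / of_int d"
    by (rule quotient_of_div[OF md])
  then have "of_int (m * v) = (of_int (u * d) :: rat)"
    using d assms(2) by (simp add: field_simps)
  then have eq: "m * v = u * d" by (simp only: of_int_eq_iff)
  have "m dvd u"
    using cop eq by (metis coprime_dvd_mult_left_iff dvd_triv_left)
  moreover have "d dvd v"
    using cop eq by (metis coprime_commute coprime_dvd_mult_right_iff dvd_triv_right)
  ultimately have "p \<in> S" if "prime p" "int p dvd m \<or> int p dvd d" for p :: nat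
    using assms(3)[OF that(1)] that(2) dvd_trans by blast
  then show ?thesis
    unfolding S_unit_def md using assms(1,2) by simp
qed

text \<open>The conditions on \<open>w ! 0\<close> serve injectivity: as \<open>w ! 0 / q\<close> is
  a positive fraction in lowest terms, the quotients \<open>w ! j / (q * r)\<close> determine
  \<open>q\<close> and then \<open>w\<close>.\<close>

definition multiple_family :: "nat \<Rightarrow> nat set \<Rightarrow> int \<Rightarrow> (int \<times> int list) set \<Rightarrow> bool" where
  "multiple_family n S r D \<longleftrightarrow> r \<noteq> 0 \<and> finite D \<and> (\<forall>(q, w)\<in>D.
     length w = n \<and> q > 0 \<and> w ! 0 > 0 \<and> coprime (w ! 0) q \<and> (\<Sum>j<n. w ! j) = q * r \<and>
     (\<forall>J\<subseteq>{..<n}. J \<noteq> {} \<longrightarrow> (\<Sum>j\<in>J. w ! j) \<noteq> 0) \<and>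
     (\<forall>p::nat. prime p \<and> (int p dvd q \<or> (\<exists>j<n. int p dvd w ! j)) \<longrightarrow> p \<in> S))"

lemma multiple_family_mono:
  assumes "multiple_family n S r D" "S \<subseteq> S'"
  shows "multiple_family n S' r D"
  using assms(1) unfolding multiple_family_def
  by (elim conjE, intro conjI ballI) (auto dest!: bspec intro: subsetD[OF assms(2)])

lemma S_unit_solutions_of_multiple_family:
  assumes D: "multiple_family n S r D"
    and a: "0 \<notin> set a" "length a = n" "n > 0"
    and Sa: "\<And>x p. x \<in> set a \<Longrightarrow> prime p
      \<Longrightarrow> int p dvd fst (quotient_of x) \<or> int p dvd snd (quotient_of x) \<Longrightarrow> p \<in> S"
    and Sr: "\<And>p. prime p \<Longrightarrow> int p dvd r \<Longrightarrow> p \<in> S"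
  shows "\<exists>X. finite X \<and> card X = card D \<and> (\<forall>x\<in>X. S_unit_solution S a x \<and> \<not> degenerate a x)"
proof -
  define sol where "sol = (\<lambda>(q :: int, w). map (\<lambda>j. of_int (w ! j) / (a ! j * of_int (q * r))) [0..<n])"
  have r: "r \<noteq> 0" using D unfolding multiple_family_def by simp
  have DD: "length w = n" "q > 0" "w ! 0 > 0" "coprime (w ! 0) q" "(\<Sum>j<n. w ! j) = q * r"
    "\<And>J. J \<subseteq> {..<n} \<Longrightarrow> J \<noteq> {} \<Longrightarrow> (\<Sum>j\<in>J. w ! j) \<noteq> 0"
    "\<And>p. prime p \<Longrightarrow> int p dvd q \<Longrightarrow> p \<in> S"
    "\<And>p j. prime p \<Longrightarrow> j < n \<Longrightarrow> int p dvd w ! j \<Longrightarrow> p \<in> S" if "(q, w) \<in> D" for q w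
    using D that unfolding multiple_family_def by blast+
  have a0: "a ! j \<noteq> 0" if "j < n" for j
    using a that by (metis nth_mem)
  have summand: "a ! j * sol (q, w) ! j = of_int (w ! j) / of_int (q * r)"
    if "j < n" for j q w
    using a0[OF that] that unfolding sol_def by simp
  have sum: "(\<Sum>j\<in>J. a ! j * sol (q, w) ! j) = of_int (\<Sum>j\<in>J. w ! j) / of_int (q * r)"
    if "J \<subseteq> {..<n}" for J q w
  proof -
    have "(\<Sum>j\<in>J. a ! j * sol (q, w) ! j) = (\<Sum>j\<in>J. of_int (w ! j) / of_int (q * r))"
      using that by (intro sum.cong refl summand) auto
    then show ?thesis by (simp add: sum_divide_distrib)
  qed
  have "inj_on sol D"
  proof (rule inj_onI)
    fix s t assume s: "s \<in> D" and t: "t \<in> D" and eq: "sol s = sol t"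
    obtain q w where s': "s = (q, w)" by (cases s)
    obtain q' w' where t': "t = (q', w')" by (cases t)
    note s = s[unfolded s'] and t = t[unfolded t']
    have cross: "w ! j * q' = w' ! j * q" if "j < n" for j
    proof -
      have "(of_int (w ! j) / of_int (q * r) :: rat) = of_int (w' ! j) / of_int (q' * r)"
        using summand[OF that, of q w] summand[OF that, of q' w'] eq unfolding s' t' by simp
      then have "(of_int (w ! j * q') :: rat) = of_int (w' ! j * q)"
        using r DD(2)[OF s] DD(2)[OF t] by (simp add: field_simps)
      then show ?thesis by (simp only: of_int_eq_iff)
    qed
    have "w ! 0 dvd w' ! 0"
      using cross[OF a(3)] DD(4)[OF s] by (metis coprime_dvd_mult_left_iff dvd_triv_left)
    moreover have "w' ! 0 dvd w ! 0"
      using cross[OF a(3)] DD(4)[OF t] by (metis coprime_dvd_mult_left_iff dvd_triv_left)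
    ultimately have "w ! 0 = w' ! 0"
      using DD(3)[OF s] DD(3)[OF t] by (simp add: zdvd_antisym_nonneg)
    with cross[OF a(3)] DD(3)[OF s] have q: "q' = q" by simp
    have "w = w'"
    proof (rule nth_equalityI)
      show "length w = length w'" using DD(1)[OF s] DD(1)[OF t] by simp
      fix j assume "j < length w"
      then show "w ! j = w' ! j"
        using cross[of j] DD(1,2)[OF s] unfolding q by simp
    qed
    with q show "s = t" unfolding s' t' by simp
  qed
  moreover have "S_unit_solution S a (sol s) \<and> \<not> degenerate a (sol s)" if "s \<in> D" for s
  proof -
    obtain q w where s': "s = (q, w)" by (cases s)
    note s = that[unfolded s']
    have "S_unit S (sol (q, w) ! j)" if j: "j < n" for j
    proof -
      obtain x y where xy: "quotient_of (a ! j) = (x, y)" by (cases "quotient_of (a ! j)")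
      have y: "y > 0" using quotient_of_denom_pos[OF xy] .
      have ax: "a ! j = of_int x / of_int y" by (rule quotient_of_div[OF xy])
      have x: "x \<noteq> 0" using a0[OF j] ax by auto
      have mem: "a ! j \<in> set a" using a(2) j by simp
      have "S_unit S (of_int (w ! j * y) / of_int (x * (q * r)))"
      proof (rule S_unit_divide)
        show "w ! j * y \<noteq> 0"
          using DD(6)[OF s, of "{j}"] y j by auto
        show "x * (q * r) \<noteq> 0" using x r DD(2)[OF s] by auto
        fix p :: nat assume p: "prime p" "int p dvd w ! j * y \<or> int p dvd x * (q * r)"
        have "prime (int p)" using p(1) by simp
        then have "int p dvd w ! j \<or> int p dvd y \<or> int p dvd x \<or> int p dvd q \<or> int p dvd r"
          using p(2) by (auto simp: prime_dvd_mult_iff)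
        then show "p \<in> S"
          using DD(7)[OF s p(1)] DD(8)[OF s p(1) j] Sa[OF mem p(1)] Sr[OF p(1)] unfolding xy by auto
      qed
      also have "of_int (w ! j * y) / of_int (x * (q * r)) = sol (q, w) ! j"
        using j unfolding sol_def by (simp add: ax)
      finally show ?thesis .
    qed
    moreover have "(\<Sum>j<n. a ! j * sol (q, w) ! j) = 1"
      unfolding sum[OF order_refl] DD(5)[OF s] using r DD(2)[OF s] by simp
    moreover have "length (sol (q, w)) = n" unfolding sol_def by simp
    moreover have "(\<Sum>j\<in>J. a ! j * sol (q, w) ! j) \<noteq> 0" if "J \<noteq> {}" "J \<subset> {..<n}" for J
    proof -
      have "J \<subseteq> {..<n}" using that by auto
      then show ?thesis
        unfolding sum[OF \<open>J \<subseteq> {..<n}\<close>] of_int_eq_0_iff divide_eq_0_iff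
        using DD(6)[OF s _ that(1)] r DD(2)[OF s] by simp
    qed
    ultimately show ?thesis
      unfolding s' S_unit_solution_def degenerate_def a(2) by auto
  qed
  moreover have "finite D" using D unfolding multiple_family_def by simp
  ultimately show ?thesis
    by (intro exI[of _ "sol ` D"]) (auto simp: card_image)
qed

section \<open>Constructing many multiples\<close>

lemma coprime_int_of_disjoint_primes:
  fixes x y :: int
  assumes "x \<noteq> 0" "P \<inter> P' = {}"
    and "\<And>p. prime p \<Longrightarrow> int p dvd x \<Longrightarrow> p \<in> P" "\<And>p. prime p \<Longrightarrow> int p dvd y \<Longrightarrow> p \<in> P'"
  shows "coprime x y"
proof (rule ccontr)
  assume "\<not> coprime x y"
  then obtain p where p: "prime p" "p dvd gcd x y"
    using assms(1) prime_divisor_exists[of "gcd x y"] by (auto simp: coprime_iff_gcd_eq_1)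
  have "p = int (nat p)" using prime_ge_0_int[OF p(1)] by simp
  with p show False
    using assms(2) assms(3,4)[of "nat p"] by (auto simp: prime_nat_iff_prime)
qed

text \<open>The entry \<open>w ! 0\<close> lies in \<open>A\<close> and has its primes in
  \<open>P\<^sub>1\<close>, whereas those of \<open>q\<close> lie in \<open>P\<^sub>2\<close>; this
  gives the coprimality. The last entry is allowed to share primes with \<open>q\<close>, as
  \<open>q * z\<close> does.\<close>

lemma multiple_family_of_popular:
  fixes A Q :: "int set" and H :: "int \<Rightarrow> (nat \<times> int) set"
  assumes A: "finite A" "card A = 2 ^ \<alpha>" "\<And>x. x \<in> A \<Longrightarrow> 0 < x \<and> x \<le> 2 ^ \<xi>"
    and k: "k > 0" and n: "n = 2 * k \<or> n = Suc (2 * k)"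
    and Q: "finite Q" "\<And>q. q \<in> Q \<Longrightarrow> 2 ^ j \<le> q \<and> q < 2 ^ (j + 1)"
    and j: "j \<le> \<xi>" "j + n + 3 \<le> \<alpha>"
    and H: "\<And>q. q \<in> Q \<Longrightarrow> finite (H q) \<and> h\<^sub>0 \<le> card (H q)"
    and H': "\<And>q c \<tau>. q \<in> Q \<Longrightarrow> (c, \<tau>) \<in> H q \<Longrightarrow> c \<in> C \<and> \<bar>\<tau>\<bar> \<le> 2 ^ \<xi> \<and> (n = Suc (2 * k) \<longleftrightarrow> \<tau> \<noteq> 0)
      \<and> 2 ^ (2 * \<alpha> * k + e) \<le> 2 * q * int (card (cong_pairs ({..<k} \<rightarrow>\<^sub>E A) (\<lambda>f. \<Sum>i<k. f i) q \<tau>))"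
    and C: "finite C" "C \<noteq> {}"
    and M: "M * (card C * (2 * n * 2 ^ (\<xi> - j))) \<le> card Q * (h\<^sub>0 * 2 ^ (2 * \<alpha> * k + e - (j + 3)))"
    and P: "P\<^sub>1 \<inter> P\<^sub>2 = {}" "\<And>x p. x \<in> A \<Longrightarrow> prime p \<Longrightarrow> int p dvd x \<Longrightarrow> p \<in> P\<^sub>1"
      "\<And>x p. x \<in> Q \<Longrightarrow> prime p \<Longrightarrow> int p dvd x \<Longrightarrow> p \<in> P\<^sub>2"
    and PH: "\<And>q c \<tau> p. q \<in> Q \<Longrightarrow> (c, \<tau>) \<in> H q \<Longrightarrow> \<tau> \<noteq> 0 \<Longrightarrow> prime p \<Longrightarrow> int p dvd \<tau>
      \<Longrightarrow> p \<in> P\<^sub>1 \<union> P\<^sub>2 \<union> {p. prime p \<and> p dvd c}"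
  shows "\<exists>c\<in>C. \<exists>r D. \<bar>r\<bar> \<le> int n * 2 ^ \<xi> \<and> M \<le> card D \<and>
    multiple_family n (P\<^sub>1 \<union> P\<^sub>2 \<union> {p. prime p \<and> p dvd c}) r D"
proof -
  obtain c r D where c: "c \<in> C" and r: "r \<noteq> 0" "\<bar>r\<bar> \<le> int n * 2 ^ \<xi>" and D: "finite D" "M \<le> card D"
    and D': "\<forall>(q, w)\<in>D. q \<in> Q \<and> (\<exists>\<tau> f f'. (c, \<tau>) \<in> H q \<and> f \<in> {..<k} \<rightarrow>\<^sub>E A \<and> f' \<in> {..<k} \<rightarrow>\<^sub>E A \<and>
      w = map (signed_tuple k f f' \<tau>) [0..<n] \<and> (\<Sum>j<n. signed_tuple k f f' \<tau> j) = q * r \<and>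
      (\<forall>J\<subseteq>{..<n}. J \<noteq> {} \<longrightarrow> (\<Sum>j\<in>J. signed_tuple k f f' \<tau> j) \<noteq> 0))"
  proof -
    have "\<exists>c\<in>C. \<exists>r. r \<noteq> 0 \<and> \<bar>r\<bar> \<le> int n * 2 ^ \<xi> \<and> (\<exists>D. finite D \<and> M \<le> card D \<and>
      (\<forall>(q, w)\<in>D. q \<in> Q \<and> (\<exists>\<tau> f f'. (c, \<tau>) \<in> H q \<and> f \<in> {..<k} \<rightarrow>\<^sub>E A \<and> f' \<in> {..<k} \<rightarrow>\<^sub>E A \<and>
        w = map (signed_tuple k f f' \<tau>) [0..<n] \<and> (\<Sum>j<n. signed_tuple k f f' \<tau> j) = q * r \<and>
        (\<forall>J\<subseteq>{..<n}. J \<noteq> {} \<longrightarrow> (\<Sum>j\<in>J. signed_tuple k f f' \<tau> j) \<noteq> 0))))"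
      by (rule exists_popular_multiple[where \<alpha> = \<alpha> and \<xi> = \<xi> and j = j and e = e and h\<^sub>0 = h\<^sub>0 and H = H])
        (fact A k n Q j H H' C M)+
    then show ?thesis by (elim bexE exE conjE) (rule that)
  qed
  let ?S = "P\<^sub>1 \<union> P\<^sub>2 \<union> {p. prime p \<and> p dvd c}"
  have "multiple_family n ?S r D"
    unfolding multiple_family_def
  proof (intro conjI r D ballI)
    fix x assume x: "x \<in> D"
    obtain q w where xqw: "x = (q, w)" by (cases x)
    obtain \<tau> f f' where q: "q \<in> Q" and \<tau>: "(c, \<tau>) \<in> H q"
      and f: "f \<in> {..<k} \<rightarrow>\<^sub>E A" "f' \<in> {..<k} \<rightarrow>\<^sub>E A"
      and w: "w = map (signed_tuple k f f' \<tau>) [0..<n]"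
      and sum: "(\<Sum>j<n. signed_tuple k f f' \<tau> j) = q * r"
      and nv: "\<forall>J\<subseteq>{..<n}. J \<noteq> {} \<longrightarrow> (\<Sum>j\<in>J. signed_tuple k f f' \<tau> j) \<noteq> 0"
      using bspec[OF D' x] unfolding xqw prod.case by (elim exE conjE) (rule that)
    have n0: "0 < n" using n k by auto
    have wj: "w ! j = signed_tuple k f f' \<tau> j" if "j < n" for j
      using that unfolding w by simp
    have sumJ: "(\<Sum>j\<in>J. w ! j) = (\<Sum>j\<in>J. signed_tuple k f f' \<tau> j)" if "J \<subseteq> {..<n}" for J
      using that by (intro sum.cong refl wj) auto
    have f0: "f 0 \<in> A" using PiE_mem[OF f(1), of 0] k by simp
    have w0: "w ! 0 = f 0" using wj[OF n0] k by (simp add: signed_tuple_def)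
    show "case x of (q, w) \<Rightarrow> length w = n \<and> q > 0 \<and> w ! 0 > 0 \<and> coprime (w ! 0) q \<and>
        (\<Sum>j<n. w ! j) = q * r \<and> (\<forall>J\<subseteq>{..<n}. J \<noteq> {} \<longrightarrow> (\<Sum>j\<in>J. w ! j) \<noteq> 0) \<and>
        (\<forall>p::nat. prime p \<and> (int p dvd q \<or> (\<exists>j<n. int p dvd w ! j)) \<longrightarrow> p \<in> ?S)"
      unfolding xqw prod.case
    proof (intro conjI allI impI)
      show "length w = n" unfolding w by simp
      have "(0::int) < 2 ^ j" by simp
      then show "q > 0" using Q(2)[OF q] by linarith
      show "w ! 0 > 0" using A(3)[OF f0] w0 by simp
      show "coprime (w ! 0) q"
        unfolding w0 using A(3)[OF f0] P(1) P(2)[OF f0] P(3)[OF q]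
        by (intro coprime_int_of_disjoint_primes[of _ P\<^sub>1 P\<^sub>2]) auto
      show "(\<Sum>j<n. w ! j) = q * r" using sumJ[OF order_refl] sum by simp
      show "(\<Sum>j\<in>J. w ! j) \<noteq> 0" if "J \<subseteq> {..<n}" "J \<noteq> {}" for J
        using sumJ[OF that(1)] nv that by simp
      fix p :: nat assume p: "prime p \<and> (int p dvd q \<or> (\<exists>j<n. int p dvd w ! j))"
      show "p \<in> ?S"
      proof (cases "int p dvd q")
        case True
        then show ?thesis using P(3)[OF q] p by auto
      next
        case False
        then obtain j where j: "j < n" "int p dvd signed_tuple k f f' \<tau> j"
          using p wj by auto
        consider "j < k" | "k \<le> j" "j < 2 * k" | "j = 2 * k" "n = Suc (2 * k)"
          using j(1) n by linarith
        then show ?thesis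
        proof cases
          case 1
          then have "f j \<in> A" using PiE_mem[OF f(1), of j] by simp
          then show ?thesis using P(2)[of "f j" p] p j(2) 1 by (simp add: signed_tuple_def)
        next
          case 2
          then have "f' (j - k) \<in> A" using PiE_mem[OF f(2), of "j - k"] by simp
          then show ?thesis using P(2)[of "f' (j - k)" p] p j(2) 2 by (simp add: signed_tuple_def)
        next
          case 3
          then show ?thesis
            using PH[OF q \<tau>] H'[OF q \<tau>] p j(2) by (simp add: signed_tuple_def)
        qed
      qed
    qed
  qed
  with c r(2) D(2) show ?thesis by (intro bexI[of _ c] exI[of _ r] exI[of _ D]) simp_all
qed

text \<open>The hypothesis of the pigeonhole step in terms of binary exponents. The exponent
  \<open>j\<close> occurs in the number of cofactors and in the density of congruent pairs and
  cancels, so \<open>le\<close> is free of it.\<close>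

lemma count_bound:
  fixes x :: nat
  assumes Q: "2 ^ \<rho> \<le> cQ * 2 ^ l" and C: "cC \<le> 2 ^ \<kappa>" and j: "j \<le> \<xi>" "j + 3 \<le> x"
    and le: "\<mu> + \<kappa> + n + \<xi> + l + 3 \<le> \<rho> + \<beta> + x" and n: "2 \<le> n"
  shows "2 ^ \<mu> * (cC * (2 * n * 2 ^ (\<xi> - j))) \<le> cQ * (2 ^ \<beta> * 2 ^ (x - (j + 3)))"
proof -
  have "2 * n \<le> 2 ^ n"
    using n by (induction n rule: nat_induct_at_least) auto
  then have "2 ^ \<mu> * (cC * (2 * n * 2 ^ (\<xi> - j))) \<le> 2 ^ \<mu> * (2 ^ \<kappa> * (2 ^ n * 2 ^ (\<xi> - j)))"
    using C by (intro mult_le_mono order_refl)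
  then have "2 ^ l * (2 ^ \<mu> * (cC * (2 * n * 2 ^ (\<xi> - j)))) \<le> 2 ^ (l + \<mu> + \<kappa> + n + (\<xi> - j))"
    by (simp add: power_add mult.assoc)
  also have "\<dots> \<le> 2 ^ (\<rho> + \<beta> + (x - (j + 3)))"
    using le j by (intro power_increasing) auto
  also have "\<dots> = 2 ^ \<rho> * (2 ^ \<beta> * 2 ^ (x - (j + 3)))"
    by (simp add: power_add mult.assoc)
  also have "\<dots> \<le> cQ * 2 ^ l * (2 ^ \<beta> * 2 ^ (x - (j + 3)))"
    using Q by (rule mult_le_mono1)
  finally have "2 ^ l * (2 ^ \<mu> * (cC * (2 * n * 2 ^ (\<xi> - j)))) \<le> 2 ^ l * (cQ * (2 ^ \<beta> * 2 ^ (x - (j + 3))))"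
    by (simp add: ac_simps)
  then show ?thesis by simp
qed

text \<open>Pigeonhole over the \<open>\<eta> + 1\<close> possible binary lengths. Fixing
  \<open>q\<close> up to a factor 2 lets one \<open>j\<close> describe both the density of the
  congruence and the range of the cofactor.\<close>

lemma exists_dyadic_block:
  fixes Q :: "int set"
  assumes "finite Q" "\<And>q. q \<in> Q \<Longrightarrow> 0 < q \<and> q \<le> 2 ^ \<eta>" "\<eta> + 1 \<le> 2 ^ l"
  obtains j Q' where "j \<le> \<eta>" "Q' \<subseteq> Q" "card Q \<le> card Q' * 2 ^ l"
    "\<And>q. q \<in> Q' \<Longrightarrow> 2 ^ j \<le> q \<and> q < 2 ^ (j + 1)"
proof -
  have "\<exists>i. i \<le> \<eta> \<and> 2 ^ i \<le> q \<and> q < 2 ^ (i + 1)" if q: "q \<in> Q" for q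
  proof -
    have "1 \<le> nat q" using assms(2)[OF q] by (simp add: Suc_le_eq)
    then obtain i where i: "2 ^ i \<le> nat q" "nat q < 2 ^ (i + 1)"
      using ex_power_ivl1[of 2 "nat q"] by blast
    have "int (2 ^ i) \<le> q" "q < int (2 ^ (i + 1))"
      using i assms(2)[OF q] by linarith+
    then have iq: "2 ^ i \<le> q" "q < 2 ^ (i + 1)" by simp_all
    then have "(2::int) ^ i \<le> 2 ^ \<eta>" using assms(2)[OF q] by linarith
    then have "i \<le> \<eta>" by simp
    with iq show ?thesis by blast
  qed
  then obtain i where i: "\<And>q. q \<in> Q \<Longrightarrow> i q \<le> \<eta> \<and> 2 ^ i q \<le> q \<and> q < 2 ^ (i q + 1)"
    by metis
  have "\<exists>j\<in>{..\<eta>}. card Q \<le> card (i -` {j} \<inter> Q) * card {..\<eta>}"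
    using assms(1) i by (intro pigeonhole_card) auto
  then obtain j where j: "j \<le> \<eta>" "card Q \<le> card (i -` {j} \<inter> Q) * (\<eta> + 1)"
    by auto
  show ?thesis
  proof (rule that[of j "i -` {j} \<inter> Q"])
    have "card (i -` {j} \<inter> Q) * (\<eta> + 1) \<le> card (i -` {j} \<inter> Q) * 2 ^ l"
      using assms(3) by (rule mult_le_mono2)
    with j(2) show "card Q \<le> card (i -` {j} \<inter> Q) * 2 ^ l" by linarith
  qed (use i j(1) in auto)
qed

text \<open>
  For odd \<open>n\<close> the last term is \<open>c * z\<close> with a small fixed integer \<open>c\<close> if, for half of the
  moduli \<open>q\<close>, the congruences \<open>g i - g j + c * z \<equiv> 0\<close> have enough solutions for every \<open>z\<close> in
  \<open>B\<^sub>1\<close>; otherwise the last term is \<open>q * z\<close> with \<open>z\<close> in \<open>B\<^sub>2\<close>, where the surplus of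
  \<open>cong_pairs_dichotomy\<close> compensates for the smaller range of \<open>z\<close>.
\<close>

lemma exists_multiple_family:
  fixes A B\<^sub>1 B\<^sub>2 Q :: "int set"
  assumes n: "n \<ge> 2"
    and A: "finite A" "card A = 2 ^ \<alpha>" "\<And>x. x \<in> A \<Longrightarrow> 0 < x \<and> x \<le> 2 ^ \<xi>"
    and B1: "finite B\<^sub>1" "card B\<^sub>1 = 2 ^ \<beta>\<^sub>1" "\<And>x. x \<in> B\<^sub>1 \<Longrightarrow> 0 < x \<and> x \<le> 2 ^ (\<xi> - e)"
    and B2: "finite B\<^sub>2" "card B\<^sub>2 = 2 ^ \<beta>\<^sub>2" "\<And>x. x \<in> B\<^sub>2 \<Longrightarrow> 0 < x \<and> x \<le> 2 ^ (\<xi> - \<eta>)"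
    and Q: "finite Q" "card Q = 2 ^ \<rho>" "\<And>x. x \<in> Q \<Longrightarrow> 0 < x \<and> x \<le> 2 ^ \<eta>"
    and P: "P\<^sub>1 \<inter> P\<^sub>2 = {}"
      "\<And>x p. x \<in> A \<union> B\<^sub>1 \<union> B\<^sub>2 \<Longrightarrow> prime p \<Longrightarrow> int p dvd x \<Longrightarrow> p \<in> P\<^sub>1"
      "\<And>x p. x \<in> Q \<Longrightarrow> prime p \<Longrightarrow> int p dvd x \<Longrightarrow> p \<in> P\<^sub>2"
    and e: "0 < e" "e \<le> \<xi>" and \<eta>: "\<eta> \<le> \<xi>" "\<eta> + n + 3 \<le> \<alpha>" "\<eta> + 1 \<le> 2 ^ l"
    and even: "\<mu> + n + \<xi> + l + 3 \<le> \<rho> + n * \<alpha>"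
    and good: "\<mu> + e + n + \<xi> + l + 4 \<le> \<rho> + \<beta>\<^sub>1 + (n - 1) * \<alpha>"
    and bad: "\<mu> + n + \<xi> + l + 4 \<le> \<rho> + \<beta>\<^sub>2 + (n - 1) * \<alpha> + e"
  shows "\<exists>c r D. 0 < c \<and> c \<le> 2 ^ \<xi> \<and> \<bar>r\<bar> \<le> int n * 2 ^ \<xi> \<and> 2 ^ \<mu> \<le> card D \<and>
    multiple_family n (P\<^sub>1 \<union> P\<^sub>2 \<union> {p. prime p \<and> p dvd c}) r D"
proof -
  obtain j Q' where j: "j \<le> \<eta>" and Q'Q: "Q' \<subseteq> Q" and cardQ': "2 ^ \<rho> \<le> card Q' * 2 ^ l"
    and Q': "\<And>q. q \<in> Q' \<Longrightarrow> 2 ^ j \<le> q \<and> q < 2 ^ (j + 1)"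
    using exists_dyadic_block[OF Q(1,3) \<eta>(3)] unfolding Q(2) by metis
  define k where "k = n div 2"
  have k: "k > 0" "n = 2 * k \<or> n = Suc (2 * k)"
    using n unfolding k_def by auto
  have j': "j \<le> \<xi>" "j + n + 3 \<le> \<alpha>"
    using j \<eta> by auto
  have finQ': "finite Q'" using Q(1) Q'Q finite_subset by blast
  let ?I = "{..<k} \<rightarrow>\<^sub>E A"
  let ?g = "\<lambda>f. \<Sum>i<k. f i"
  have finI: "finite ?I" using A(1) by (auto intro: finite_PiE)
  have cardI: "(int (card ?I))\<^sup>2 = 2 ^ (2 * \<alpha> * k)"
    using A(2) by (simp add: card_PiE ac_simps flip: power_mult)
  have qpos: "0 < q" if "q \<in> Q'" for q
    using Q(3) Q'Q that by auto
  have "\<alpha> \<le> 2 * \<alpha> * k" using k(1) by (cases k) auto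
  then have jx: "j + 3 \<le> 2 * \<alpha> * k + x" for x
    using j' by linarith
  note PA = P(1) P(2)[OF UnI1[OF UnI1]] P(3)[OF subsetD[OF Q'Q]]
  show ?thesis
  proof (cases "n = 2 * k")
    case True
    have "\<exists>c\<in>{1}. \<exists>r D. \<bar>r\<bar> \<le> int n * 2 ^ \<xi> \<and> 2 ^ \<mu> \<le> card D \<and>
      multiple_family n (P\<^sub>1 \<union> P\<^sub>2 \<union> {p. prime p \<and> p dvd c}) r D"
    proof (rule multiple_family_of_popular[OF A k finQ' Q' j', where H = "\<lambda>_. {(1, 0)}"
          and h\<^sub>0 = "2 ^ 0" and e = 0 and P\<^sub>1 = P\<^sub>1 and P\<^sub>2 = P\<^sub>2])
      show "2 ^ \<mu> * (card {1::nat} * (2 * n * 2 ^ (\<xi> - j)))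
          \<le> card Q' * (2 ^ 0 * 2 ^ (2 * \<alpha> * k + 0 - (j + 3)))"
        using even True by (intro count_bound[OF cardQ' _ j'(1) jx _ n, of _ 0]) (auto simp: ac_simps)
      fix q c \<tau> assume q: "q \<in> Q'" and "(c, \<tau>) \<in> {(1::nat, 0::int)}"
      moreover have "2 ^ (2 * \<alpha> * k) \<le> q * int (card (cong_pairs ?I ?g q 0))"
        using card_squared_le_card_cong_pairs[OF finI qpos[OF q], of ?g] unfolding cardI .
      moreover have "\<dots> \<le> 2 * q * int (card (cong_pairs ?I ?g q 0))"
        using qpos[OF q] by (intro mult_right_mono) auto
      ultimately show "c \<in> {1} \<and> \<bar>\<tau>\<bar> \<le> 2 ^ \<xi> \<and> (n = Suc (2 * k) \<longleftrightarrow> \<tau> \<noteq> 0) \<and>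
          2 ^ (2 * \<alpha> * k + 0) \<le> 2 * q * int (card (cong_pairs ?I ?g q \<tau>))"
        using True by auto
    qed (use PA in auto)
    then obtain r D where "\<bar>r\<bar> \<le> int n * 2 ^ \<xi>" "2 ^ \<mu> \<le> card D"
      "multiple_family n (P\<^sub>1 \<union> P\<^sub>2 \<union> {p. prime p \<and> p dvd 1}) r D" by blast
    then show ?thesis by (intro exI[of _ "1 :: nat"] exI[of _ r] exI[of _ D]) simp
  next
    case False
    with k have nk: "n = Suc (2 * k)" by simp
    \<comment> \<open>Failure at \<open>q\<close> supplies a \<open>z\<close> none of whose
      multiples \<open>c * z\<close> works, which is the hypothesis of
      \<open>cong_pairs_dichotomy\<close> with \<open>C = 2 ^ e\<close>. The multiplier may depend
      on \<open>q\<close> and \<open>z\<close>; fixing it by pigeonhole costs the factor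
      \<open>2 ^ e\<close>.\<close>
    define ample where "ample q \<longleftrightarrow> (\<forall>z\<in>B\<^sub>1. \<exists>c\<in>{1..<2 ^ e}.
      (int (card ?I))\<^sup>2 \<le> 2 * q * int (card (cong_pairs ?I ?g q (int c * z))))" for q
    have bad_pairs: "2 ^ (2 * \<alpha> * k + e) \<le> 2 * q * int (card (cong_pairs ?I ?g q 0))"
      if q: "q \<in> Q'" "\<not> ample q" for q
    proof -
      obtain z where "2 * q * int (card (cong_pairs ?I ?g q (int c * z))) < (int (card ?I))\<^sup>2"
        if "c \<in> {1..<2 ^ e}" for c
        using q(2) unfolding ample_def by (meson not_le_imp_less)
      then have "int (2 ^ e) * (int (card ?I))\<^sup>2 \<le> 2 * q * int (card (cong_pairs ?I ?g q 0))"
        using finI qpos[OF q(1)] by (intro cong_pairs_dichotomy) auto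
      then show ?thesis unfolding cardI by (simp add: power_add mult.commute)
    qed
    \<comment> \<open>Restricting to half of the moduli replaces \<open>l\<close> by
      \<open>l + 1\<close>; hence the 4 in \<open>good\<close> and \<open>bad\<close> against the 3
      in \<open>even\<close>.\<close>
    have double: "2 ^ \<rho> \<le> m * 2 ^ (l + 1)" if "card Q' \<le> 2 * m" for m
      using order_trans[OF cardQ' mult_le_mono1[OF that]] by (simp add: ac_simps)
    have "card Q' = card {q \<in> Q'. ample q} + card {q \<in> Q'. \<not> ample q}"
      using finQ' by (subst card_Un_disjoint[symmetric]) (auto intro: arg_cong[where f = card])
    then have "card Q' \<le> 2 * card {q \<in> Q'. ample q} \<or> card Q' \<le> 2 * card {q \<in> Q'. \<not> ample q}"
      by linarith
    then show ?thesis
    proof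
      assume "card Q' \<le> 2 * card {q \<in> Q'. ample q}"
      then have half: "2 ^ \<rho> \<le> card {q \<in> Q'. ample q} * 2 ^ (l + 1)" by (rule double)
      let ?Q = "{q \<in> Q'. ample q}"
      define ch where "ch q z = (SOME c. c \<in> {1..<2 ^ e} \<and>
        (int (card ?I))\<^sup>2 \<le> 2 * q * int (card (cong_pairs ?I ?g q (int c * z))))" for q z
      have ch: "ch q z \<in> {1..<2 ^ e} \<and>
          (int (card ?I))\<^sup>2 \<le> 2 * q * int (card (cong_pairs ?I ?g q (int (ch q z) * z)))"
        if "q \<in> ?Q" "z \<in> B\<^sub>1" for q z
      proof -
        have "\<exists>c\<in>{1..<2 ^ e}. (int (card ?I))\<^sup>2 \<le> 2 * q * int (card (cong_pairs ?I ?g q (int c * z)))"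
          using that unfolding ample_def by simp
        then show ?thesis unfolding ch_def Bex_def by (rule someI_ex)
      qed
      define H where "H q = (\<lambda>z. (ch q z, int (ch q z) * z)) ` B\<^sub>1" for q
      have "\<exists>c\<in>{1..<2 ^ e}. \<exists>r D. \<bar>r\<bar> \<le> int n * 2 ^ \<xi> \<and> 2 ^ \<mu> \<le> card D \<and>
        multiple_family n (P\<^sub>1 \<union> P\<^sub>2 \<union> {p. prime p \<and> p dvd c}) r D"
      proof (rule multiple_family_of_popular[OF A k _ _ j', where Q = ?Q and H = H and h\<^sub>0 = "2 ^ \<beta>\<^sub>1"
            and e = 0 and P\<^sub>1 = P\<^sub>1 and P\<^sub>2 = P\<^sub>2])
        show "2 ^ \<mu> * (card {1..<2 ^ e :: nat} * (2 * n * 2 ^ (\<xi> - j)))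
            \<le> card ?Q * (2 ^ \<beta>\<^sub>1 * 2 ^ (2 * \<alpha> * k + 0 - (j + 3)))"
          using good nk
          by (intro count_bound[OF half _ j'(1) jx _ n, of _ e]) (auto simp: ac_simps)
        have "(1::nat) < 2 ^ e" using e(1) by (intro one_less_power) simp_all
        then show "{1..<2 ^ e :: nat} \<noteq> {}" by auto
        fix q assume q: "q \<in> ?Q"
        have "inj_on (\<lambda>z. (ch q z, int (ch q z) * z)) B\<^sub>1"
          using ch[OF q] by (intro inj_onI) force
        then show "finite (H q) \<and> 2 ^ \<beta>\<^sub>1 \<le> card (H q)"
          unfolding H_def using B1(1,2) by (simp add: card_image)
        fix c \<tau> assume "(c, \<tau>) \<in> H q"
        then obtain z where z: "z \<in> B\<^sub>1" "c = ch q z" "\<tau> = int c * z"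
          unfolding H_def by auto
        have c: "c \<in> {1..<2 ^ e}" "(int (card ?I))\<^sup>2 \<le> 2 * q * int (card (cong_pairs ?I ?g q \<tau>))"
          using ch[OF q z(1)] unfolding z(2,3) by auto
        have "int c * z \<le> 2 ^ e * 2 ^ (\<xi> - e)"
        proof (rule mult_mono)
          have "int c \<le> int (2 ^ e)" using c(1) by (simp only: of_nat_le_iff) simp
          then show "int c \<le> 2 ^ e" by simp
        qed (use B1(3)[OF z(1)] in auto)
        also have "\<dots> = 2 ^ \<xi>" using e(2) by (simp flip: power_add)
        finally have "\<bar>\<tau>\<bar> \<le> 2 ^ \<xi>" using B1(3)[OF z(1)] unfolding z(3) by (simp add: abs_mult)
        moreover have "\<tau> \<noteq> 0" using c(1) B1(3)[OF z(1)] unfolding z(3) by auto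
        ultimately show "c \<in> {1..<2 ^ e} \<and> \<bar>\<tau>\<bar> \<le> 2 ^ \<xi> \<and> (n = Suc (2 * k) \<longleftrightarrow> \<tau> \<noteq> 0) \<and>
            2 ^ (2 * \<alpha> * k + 0) \<le> 2 * q * int (card (cong_pairs ?I ?g q \<tau>))"
          using c nk unfolding cardI by simp
        fix p :: nat assume p: "prime p" "int p dvd \<tau>"
        have "prime (int p)" using p(1) by simp
        then have "int p dvd int c \<or> int p dvd z"
          using p(2) unfolding z(3) by (simp add: prime_dvd_mult_iff)
        then show "p \<in> P\<^sub>1 \<union> P\<^sub>2 \<union> {p. prime p \<and> p dvd c}"
          using P(2)[of z p] z(1) p(1) by auto
      qed (use PA finQ' Q' in auto)
      then obtain c r D where crD: "c \<in> {1..<2 ^ e}" "\<bar>r\<bar> \<le> int n * 2 ^ \<xi>" "2 ^ \<mu> \<le> card D"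
        "multiple_family n (P\<^sub>1 \<union> P\<^sub>2 \<union> {p. prime p \<and> p dvd c}) r D" by blast
      have "(2::nat) ^ e \<le> 2 ^ \<xi>" using e(2) by (intro power_increasing) auto
      moreover have "0 < c" "c < 2 ^ e" using crD(1) by simp_all
      ultimately have "0 < c" "c \<le> 2 ^ \<xi>" by linarith+
      with crD(2-4) show ?thesis
        by (intro exI[of _ c] exI[of _ r] exI[of _ D]) simp
    next
      assume "card Q' \<le> 2 * card {q \<in> Q'. \<not> ample q}"
      then have half: "2 ^ \<rho> \<le> card {q \<in> Q'. \<not> ample q} * 2 ^ (l + 1)" by (rule double)
      let ?Q = "{q \<in> Q'. \<not> ample q}"
      define H where "H q = (\<lambda>z. (1 :: nat, q * z)) ` B\<^sub>2" for q
      have "\<exists>c\<in>{1}. \<exists>r D. \<bar>r\<bar> \<le> int n * 2 ^ \<xi> \<and> 2 ^ \<mu> \<le> card D \<and>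
        multiple_family n (P\<^sub>1 \<union> P\<^sub>2 \<union> {p. prime p \<and> p dvd c}) r D"
      proof (rule multiple_family_of_popular[OF A k _ _ j', where Q = ?Q and H = H and h\<^sub>0 = "2 ^ \<beta>\<^sub>2"
            and e = e and P\<^sub>1 = P\<^sub>1 and P\<^sub>2 = P\<^sub>2])
        show "2 ^ \<mu> * (card {1 :: nat} * (2 * n * 2 ^ (\<xi> - j)))
            \<le> card ?Q * (2 ^ \<beta>\<^sub>2 * 2 ^ (2 * \<alpha> * k + e - (j + 3)))"
          using bad nk by (intro count_bound[OF half _ j'(1) jx _ n, of _ 0]) (auto simp: ac_simps)
        fix q assume q: "q \<in> ?Q"
        have q0: "0 < q" "q \<le> 2 ^ \<eta>" using q Q(3) Q'Q by auto
        have "inj_on (\<lambda>z. (1 :: nat, q * z)) B\<^sub>2"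
          using q0 by (intro inj_onI) auto
        then show "finite (H q) \<and> 2 ^ \<beta>\<^sub>2 \<le> card (H q)"
          unfolding H_def using B2(1,2) by (simp add: card_image)
        fix c \<tau> assume "(c, \<tau>) \<in> H q"
        then obtain z where z: "z \<in> B\<^sub>2" "c = 1" "\<tau> = q * z"
          unfolding H_def by auto
        have "q * z \<le> 2 ^ \<eta> * 2 ^ (\<xi> - \<eta>)"
          using q0 B2(3)[OF z(1)] by (intro mult_mono) auto
        also have "\<dots> = 2 ^ \<xi>" using \<eta>(1) by (simp flip: power_add)
        finally have "\<bar>\<tau>\<bar> \<le> 2 ^ \<xi>" using B2(3)[OF z(1)] q0 unfolding z(3) by (simp add: abs_mult)
        moreover have "\<tau> \<noteq> 0" using q0 B2(3)[OF z(1)] unfolding z(3) by auto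
        \<comment> \<open>A multiple of \<open>q\<close> does not affect the congruence, so the
          surplus known for the shift 0 holds for every \<open>\<tau> = q * z\<close>.\<close>
        moreover have "cong_pairs ?I ?g q \<tau> = cong_pairs ?I ?g q 0"
          unfolding cong_pairs_def z(3) by (simp add: dvd_add_left_iff)
        ultimately show "c \<in> {1} \<and> \<bar>\<tau>\<bar> \<le> 2 ^ \<xi> \<and> (n = Suc (2 * k) \<longleftrightarrow> \<tau> \<noteq> 0) \<and>
            2 ^ (2 * \<alpha> * k + e) \<le> 2 * q * int (card (cong_pairs ?I ?g q \<tau>))"
          using bad_pairs[of q] q z(2) nk by simp
        fix p :: nat assume p: "prime p" "int p dvd \<tau>"
        have "prime (int p)" using p(1) by simp
        then have "int p dvd q \<or> int p dvd z"
          using p(2) unfolding z(3) by (simp add: prime_dvd_mult_iff)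
        then show "p \<in> P\<^sub>1 \<union> P\<^sub>2 \<union> {p. prime p \<and> p dvd c}"
          using P(2)[of z p] P(3)[of q p] q Q'Q z(1) p(1) by auto
      qed (use PA finQ' Q' in auto)
      then obtain r D where "\<bar>r\<bar> \<le> int n * 2 ^ \<xi>" "2 ^ \<mu> \<le> card D"
        "multiple_family n (P\<^sub>1 \<union> P\<^sub>2 \<union> {p. prime p \<and> p dvd 1}) r D" by blast
      then show ?thesis by (intro exI[of _ "1 :: nat"] exI[of _ r] exI[of _ D]) simp
    qed
  qed
qed

section \<open>Choice of parameters\<close>

text \<open>
  With \<open>T = 2 ^ t\<close>, each of the two sets of primes has \<open>T ^ N\<close> elements of size at most
  \<open>T ^ (N + 1)\<close>. Products of \<open>V u\<close> of them, \<open>V \<le> L = 2 n + 2\<close>, are at most \<open>T ^ ((N + 1) V u)\<close>,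
  and there are at least \<open>T ^ (a V u)\<close> of them; \<open>V\<close> is \<open>L\<close> for \<open>A\<close>, \<open>L - 1\<close> for \<open>B\<^sub>1\<close>,
  \<open>L - 2\<close> for \<open>B\<^sub>2\<close> and \<open>2\<close> for \<open>Q\<close>. The value of \<open>a\<close> makes the gain from varying \<open>q\<close>
  outweigh all losses, and \<open>u = (T ^ N) powr (1 - 1 / n)\<close>.
\<close>

definition par_a :: "nat \<Rightarrow> nat" where "par_a n = 4 * (n + 1)\<^sup>2 + 6"
definition par_N :: "nat \<Rightarrow> nat" where "par_N n = n * (par_a n + 1)"
definition par_u :: "nat \<Rightarrow> nat \<Rightarrow> nat" where "par_u n t = 2 ^ ((n - 1) * (par_a n + 1) * t)"

text \<open>With \<open>m = (n + 1)\<^sup>2\<close> one has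
  \<open>b * L = n * (a * L) + 2 * m\<close>. The first three lines are the conditions
  \<open>even\<close>, \<open>good\<close> and \<open>bad\<close> divided by
  \<open>g = t * u\<close>; the 3 pays for the number of solutions, for the dyadic block and for
  additive constants. The third forces \<open>e \<ge> 2 * m + 3\<close> and the second
  \<open>a \<ge> 2 * m + e + 3\<close>, and both hold with equality. In the last line, the second
  inequality makes \<open>card A\<close> larger than \<open>q\<close>, where
  \<open>L = 2 * n + 2\<close> enters, and the final two keep \<open>c * z\<close> and
  \<open>q * z\<close> within the common bound.\<close>

lemma par_ineqs:
  assumes "n \<ge> 2" and a: "a = par_a n" and b: "b = par_N n + 1" and L: "L = 2 * n + 2"
    and e: "e = 2 * (n + 1)\<^sup>2 + 3"
  shows "3 + b * L \<le> 2 * a + n * (a * L)"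
    "3 + e + b * L \<le> 2 * a + a * (L - 1) + (n - 1) * (a * L)"
    "3 + b * L \<le> 2 * a + a * (L - 2) + (n - 1) * (a * L) + e"
    "e \<le> b" "2 * b + 1 \<le> a * L" "b * (L - 1) + e \<le> b * L" "b * (L - 2) + 2 * b = b * L"
proof -
  define m where "m = (n + 1)\<^sup>2"
  have am: "a = 4 * m + 6" and em: "e = 2 * m + 3"
    unfolding a e par_a_def m_def by simp_all
  have bna: "b = n * a + n + 1" unfolding b a par_N_def by simp
  have "n * (a * L) = (n - 1 + 1) * (a * L)" using assms(1) by simp
  then have nL: "n * (a * L) = (n - 1) * (a * L) + a * L" unfolding add_mult_distrib by simp
  have "b * L = n * (a * L) + (n + 1) * L"
    unfolding bna by (simp add: algebra_simps)
  moreover have "(n + 1) * L = 2 * m"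
    unfolding L m_def by (simp add: power2_eq_square algebra_simps)
  ultimately have bL: "b * L = n * (a * L) + 2 * m" by simp
  have aL: "a * L = a * (L - 1) + a" "a * L = a * (L - 2) + 2 * a"
    unfolding L by (simp_all add: algebra_simps)
  show "3 + b * L \<le> 2 * a + n * (a * L)"
    "3 + e + b * L \<le> 2 * a + a * (L - 1) + (n - 1) * (a * L)"
    "3 + b * L \<le> 2 * a + a * (L - 2) + (n - 1) * (a * L) + e"
    using am em nL bL aL by linarith+
  have "a \<le> n * a" using assms(1) by simp
  then show eb: "e \<le> b" using am em bna by linarith
  have "a * L = 2 * (n * a) + 2 * a" unfolding L by (simp add: algebra_simps)
  moreover have "n \<le> m" unfolding m_def by (simp add: power2_eq_square)
  ultimately show "2 * b + 1 \<le> a * L" using am bna by linarith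
  have "b * (L - 1) + b = b * L" unfolding L by (simp add: algebra_simps)
  with eb show "b * (L - 1) + e \<le> b * L" by linarith
  show "b * (L - 2) + 2 * b = b * L" unfolding L by (simp add: algebra_simps)
qed

lemma exists_smooth_numbers_power_of_two:
  fixes P :: "nat set"
  assumes "finite P" "\<And>p. p \<in> P \<Longrightarrow> prime p \<and> p \<le> 2 ^ y" "V > 0" "V * 2 ^ x \<le> card P"
    "\<beta> = x * V" "\<zeta> = y * V"
  obtains A :: "int set" where "finite A" "card A = 2 ^ \<beta>"
    "\<And>x. x \<in> A \<Longrightarrow> 0 < x \<and> x \<le> 2 ^ \<zeta>"
    "\<And>x p. x \<in> A \<Longrightarrow> prime p \<Longrightarrow> int p dvd x \<Longrightarrow> p \<in> P"
proof -
  obtain A :: "int set" where "finite A" "card A = (2 ^ x) ^ V"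
    "\<And>x. x \<in> A \<Longrightarrow> 0 < x \<and> x \<le> int (2 ^ y) ^ V"
    "\<And>x p. x \<in> A \<Longrightarrow> prime p \<Longrightarrow> int p dvd x \<Longrightarrow> p \<in> P"
    using exists_smooth_numbers[OF assms(1-4)] by blast
  then show ?thesis
    using that[of A] assms(5,6) by (simp flip: power_mult)
qed

lemma multiple_family_for_parameters:
  fixes n t :: nat
  defines "a \<equiv> par_a n" and "b \<equiv> par_N n + 1" and "L \<equiv> 2 * n + 2"
    and "u \<equiv> par_u n t" and "K \<equiv> 2 ^ (par_N n * t)"
  assumes n: "n \<ge> 2" and t: "L \<le> 2 ^ t" "4 * b * t \<le> 2 ^ t" "n + 4 \<le> t"
  shows "\<exists>P c r D. finite P \<and> (\<forall>p\<in>P. prime p) \<and> card P = 2 * K \<and> 0 < c \<and> c \<le> 2 ^ (b * L * (t * u)) \<and>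
    \<bar>r\<bar> \<le> int n * 2 ^ (b * L * (t * u)) \<and> 2 ^ (t * u) \<le> card D \<and>
    multiple_family n (P \<union> {p. prime p \<and> p dvd c}) r D"
proof -
  define g where "g = t * u"
  define e where "e = 2 * (n + 1)\<^sup>2 + 3"
  note ineqs = par_ineqs[OF n a_def[THEN meta_eq_to_obj_eq] b_def[THEN meta_eq_to_obj_eq]
      L_def[THEN meta_eq_to_obj_eq] e_def]
  have u0: "u > 0" unfolding u_def par_u_def by simp
  have tg: "t \<le> g" unfolding g_def using u0 by simp
  have b0: "b > 0" unfolding b_def by simp
  \<comment> \<open>The factor \<open>2 * b * t\<close> lost in the Chebyshev bound, and the 2 for
    having two sets of primes, are paid by the factor \<open>2 ^ t\<close> by which the range
    \<open>2 ^ (b * t)\<close> exceeds \<open>K\<close>.\<close>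
  have "2 * K * (b * t) \<le> 2 ^ (b * t - 1)"
  proof -
    have "b * t > 0" using b0 t(3) by simp
    then have "2 * 2 ^ (b * t - 1) = (2 ^ (b * t) :: nat)"
      by (cases "b * t") auto
    also have "\<dots> = 2 ^ t * K" unfolding b_def K_def by (simp add: algebra_simps power_add)
    finally have "2 ^ t * K = 2 * 2 ^ (b * t - 1)" by simp
    moreover have "4 * b * t * K \<le> 2 ^ t * K" using t(2) by (rule mult_le_mono1)
    ultimately show ?thesis by (simp add: ac_simps)
  qed
  then have "2 * K \<le> card {p::nat. prime p \<and> p \<le> 2 ^ (b * t)}"
    using b0 t(3) by (intro card_primes_up_to_power_of_two_ge) auto
  then obtain P :: "nat set" where P: "P \<subseteq> {p. prime p \<and> p \<le> 2 ^ (b * t)}" "card P = 2 * K" "finite P"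
    by (rule obtain_subset_with_card_n)
  obtain P\<^sub>1 where P1: "P\<^sub>1 \<subseteq> P" "card P\<^sub>1 = K" "finite P\<^sub>1"
    using obtain_subset_with_card_n[of K P] P(2) by auto
  define P\<^sub>2 where "P\<^sub>2 = P - P\<^sub>1"
  have P2: "P\<^sub>2 \<subseteq> P" "card P\<^sub>2 = K" "finite P\<^sub>2" "P\<^sub>1 \<inter> P\<^sub>2 = {}" "P = P\<^sub>1 \<union> P\<^sub>2"
    using P P1 unfolding P\<^sub>2_def by (auto simp: card_Diff_subset)
  have Pp: "prime p \<and> p \<le> 2 ^ (b * t)" if "p \<in> P" for p using P(1) that by auto
  \<comment> \<open>This fixes \<open>par_N\<close> and \<open>par_u\<close>: in powers of
    \<open>2 ^ t\<close>, the factors \<open>V\<close>, \<open>2 ^ (a * t)\<close> and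
    \<open>u\<close> take 1, \<open>a\<close> and \<open>(n - 1) * (a + 1)\<close>, together
    \<open>n * (a + 1)\<close>.\<close>
  have VK: "V * u * 2 ^ (a * t) \<le> K" if "V \<le> L" for V
  proof -
    have "V * u * 2 ^ (a * t) \<le> 2 ^ t * u * 2 ^ (a * t)"
      using that t(1) by (intro mult_le_mono1) simp
    also have "\<dots> = 2 ^ ((a + 1) * t + (n - 1) * (a + 1) * t)"
      unfolding u_def par_u_def a_def[symmetric] by (simp add: power_add ac_simps)
    also have "(a + 1) * t + (n - 1) * (a + 1) * t = (1 + (n - 1)) * ((a + 1) * t)"
      by (simp only: add_mult_distrib mult_1 mult.assoc)
    also have "\<dots> = par_N n * t"
      using n unfolding par_N_def a_def[symmetric] by (simp add: mult.assoc del: add_mult_distrib mult_Suc_right mult_Suc)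
    finally show ?thesis unfolding K_def .
  qed
  have smooth: "\<exists>A :: int set. finite A \<and> card A = 2 ^ (a * V * g) \<and>
      (\<forall>x\<in>A. 0 < x \<and> x \<le> 2 ^ (b * V * g)) \<and> (\<forall>x\<in>A. \<forall>p. prime p \<longrightarrow> int p dvd x \<longrightarrow> p \<in> R)"
    if R: "finite R" "R \<subseteq> P" "card R = K" and V: "0 < V" "V \<le> L" for R V
  proof -
    have "V * u > 0" using V(1) u0 by simp
    moreover have "V * u * 2 ^ (a * t) \<le> card R" using VK[OF V(2)] R(3) by simp
    moreover have "a * V * g = a * t * (V * u)" "b * V * g = b * t * (V * u)"
      unfolding g_def by (simp_all add: ac_simps)
    ultimately obtain A :: "int set" where "finite A" "card A = 2 ^ (a * V * g)"
      "\<And>x. x \<in> A \<Longrightarrow> 0 < x \<and> x \<le> 2 ^ (b * V * g)"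
      "\<And>x p. x \<in> A \<Longrightarrow> prime p \<Longrightarrow> int p dvd x \<Longrightarrow> p \<in> R"
      using exists_smooth_numbers_power_of_two[OF R(1) Pp[OF subsetD[OF R(2)]]] by metis
    then show ?thesis by (intro exI[of _ A]) simp
  qed
  have L: "0 < L" "L \<le> L" "0 < L - 1" "L - 1 \<le> L" "0 < L - 2" "L - 2 \<le> L" "0 < (2 :: nat)" "2 \<le> L"
    using n unfolding L_def by auto
  obtain A :: "int set" where A: "finite A" "card A = 2 ^ (a * L * g)"
      "\<And>x. x \<in> A \<Longrightarrow> 0 < x \<and> x \<le> 2 ^ (b * L * g)" and AP: "\<And>x p. x \<in> A \<Longrightarrow> prime p \<Longrightarrow> int p dvd x \<Longrightarrow> p \<in> P\<^sub>1"
    using smooth[OF P1(3,1,2) L(1,2)] by metis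
  obtain B\<^sub>1 :: "int set" where B1: "finite B\<^sub>1" "card B\<^sub>1 = 2 ^ (a * (L - 1) * g)"
      "\<And>x. x \<in> B\<^sub>1 \<Longrightarrow> 0 < x \<and> x \<le> 2 ^ (b * (L - 1) * g)" and B1P: "\<And>x p. x \<in> B\<^sub>1 \<Longrightarrow> prime p \<Longrightarrow> int p dvd x \<Longrightarrow> p \<in> P\<^sub>1"
    using smooth[OF P1(3,1,2) L(3,4)] by metis
  obtain B\<^sub>2 :: "int set" where B2: "finite B\<^sub>2" "card B\<^sub>2 = 2 ^ (a * (L - 2) * g)"
      "\<And>x. x \<in> B\<^sub>2 \<Longrightarrow> 0 < x \<and> x \<le> 2 ^ (b * (L - 2) * g)" and B2P: "\<And>x p. x \<in> B\<^sub>2 \<Longrightarrow> prime p \<Longrightarrow> int p dvd x \<Longrightarrow> p \<in> P\<^sub>1"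
    using smooth[OF P1(3,1,2) L(5,6)] by metis
  obtain Q :: "int set" where Q: "finite Q" "card Q = 2 ^ (a * 2 * g)"
      "\<And>x. x \<in> Q \<Longrightarrow> 0 < x \<and> x \<le> 2 ^ (b * 2 * g)" and QP: "\<And>x p. x \<in> Q \<Longrightarrow> prime p \<Longrightarrow> int p dvd x \<Longrightarrow> p \<in> P\<^sub>2"
    using smooth[OF P2(3,1,2) L(7,8)] by metis
  have B1': "0 < x \<and> x \<le> 2 ^ (b * L * g - e * g)" if "x \<in> B\<^sub>1" for x
  proof -
    have "b * (L - 1) * g + e * g \<le> b * L * g"
      using mult_le_mono1[OF ineqs(6), of g] by (simp add: add_mult_distrib)
    then have "(2::int) ^ (b * (L - 1) * g) \<le> 2 ^ (b * L * g - e * g)"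
      by (intro power_increasing) auto
    with B1(3)[OF that] show ?thesis by linarith
  qed
  have B2': "0 < x \<and> x \<le> 2 ^ (b * L * g - b * 2 * g)" if "x \<in> B\<^sub>2" for x
  proof -
    have "b * L * g = b * (L - 2) * g + b * 2 * g"
      unfolding ineqs(7)[symmetric] by (simp add: add_mult_distrib add_mult_distrib2 ac_simps)
    then show ?thesis using B2(3)[OF that] by simp
  qed
  have gg: "4 * b * g \<le> 2 ^ g"
    using tg
  proof (induction g rule: dec_induct)
    case base
    show ?case by (rule t(2))
  next
    case (step m)
    have "1 \<le> m" using step.hyps t(3) by linarith
    then have "b \<le> b * m" by simp
    then have "4 * b * Suc m \<le> 2 * (4 * b * m)" by simp
    also have "\<dots> \<le> 2 ^ Suc m" using step.IH by simp
    finally show ?case .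
  qed
  have g4: "n + 4 \<le> g" using tg t(3) by simp
  have bg: "1 \<le> b * g" using b0 g4 by simp
  have "\<exists>c r D. 0 < c \<and> c \<le> 2 ^ (b * L * g) \<and> \<bar>r\<bar> \<le> int n * 2 ^ (b * L * g) \<and> 2 ^ g \<le> card D \<and>
    multiple_family n (P\<^sub>1 \<union> P\<^sub>2 \<union> {p. prime p \<and> p dvd c}) r D"
  proof (rule exists_multiple_family[OF n A B1(1,2) B1' B2(1,2) B2' Q P2(4), where l = g])
    show "0 < e * g" unfolding e_def using g4 by simp
    have "e \<le> b * L" using ineqs(4,6) by linarith
    then show "e * g \<le> b * L * g" by (rule mult_le_mono1)
    have "b * 2 \<le> b * L" using L by (intro mult_le_mono2)
    then show "b * 2 * g \<le> b * L * g" by (rule mult_le_mono1)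
    show "b * 2 * g + n + 3 \<le> a * L * g"
      using mult_le_mono1[OF ineqs(5), of g] g4 by (simp add: add_mult_distrib add_mult_distrib2 ac_simps)
    show "b * 2 * g + 1 \<le> 2 ^ g"
    proof -
      have "b * 2 * g = 2 * (b * g)" "4 * b * g = 4 * (b * g)" by (simp_all add: ac_simps)
      then show ?thesis using gg bg by linarith
    qed
    show "g + n + b * L * g + g + 3 \<le> a * 2 * g + n * (a * L * g)"
      using mult_le_mono1[OF ineqs(1), of g] g4 by (simp add: add_mult_distrib add_mult_distrib2 ac_simps)
    show "g + e * g + n + b * L * g + g + 4 \<le> a * 2 * g + a * (L - 1) * g + (n - 1) * (a * L * g)"
      using mult_le_mono1[OF ineqs(2), of g] g4 by (simp add: add_mult_distrib add_mult_distrib2 ac_simps)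
    show "g + n + b * L * g + g + 4 \<le> a * 2 * g + a * (L - 2) * g + (n - 1) * (a * L * g) + e * g"
      using mult_le_mono1[OF ineqs(3), of g] g4 by (simp add: add_mult_distrib add_mult_distrib2 ac_simps)
  qed (use AP B1P B2P QP in auto)
  then obtain c r D where "0 < c" "c \<le> 2 ^ (b * L * g)" "\<bar>r\<bar> \<le> int n * 2 ^ (b * L * g)" "2 ^ g \<le> card D"
    "multiple_family n (P \<union> {p. prime p \<and> p dvd c}) r D"
    unfolding P2(5)[symmetric] by auto
  then show ?thesis
    using P Pp unfolding g_def
    by (intro exI[of _ P] exI[of _ c] exI[of _ r] exI[of _ D]) simp
qed

section \<open>The bound\<close>

text \<open>As \<open>s\<close> is within a constant factor of \<open>2 ^ (par_N n * t)\<close>, the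
  power \<open>s powr (1 - 1 / n)\<close> is at most a constant times \<open>par_u n t\<close>. The
  other factors are bounded by \<open>2 * n\<close> and 1, and the lower bound on \<open>t\<close>
  absorbs all constants.\<close>

lemma target_le_two_power:
  fixes n s t :: nat and \<epsilon> :: real
  assumes n: "n \<ge> 2" and s: "4 \<le> s" "s \<le> 2 ^ (par_N n * (t + 1) + 2)"
    and t: "n * 2 ^ (par_N n + 4) \<le> t" and \<epsilon>: "\<epsilon> > 0"
  shows "exp ((1 - \<epsilon>) * ((real n)\<^sup>2 / (real n - 1)) * real s powr (1 - 1 / real n) *
      ln (real s) powr (- 1 / real n)) \<le> 2 ^ (t * par_u n t)"
proof -
  let ?N = "par_N n" and ?u = "par_u n t"
  define X where "X = real s powr (1 - 1 / real n)"
  define Y where "Y = ln (real s) powr (- 1 / real n)"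
  have n1: "real n - 1 > 0" using n by simp
  have "exp 1 \<le> real s" using exp_le s(1) by linarith
  then have ln1: "1 \<le> ln (real s)" using s(1) by (simp add: ln_ge_iff)
  have Y: "0 \<le> Y" "Y \<le> 1"
    unfolding Y_def using ln1 powr_mono2'[of "- 1 / real n" 1 "ln (real s)"] by simp_all
  have "X \<le> (2 ^ (?N * (t + 1) + 2)) powr (1 - 1 / real n)"
  proof -
    have "real s \<le> real (2 ^ (?N * (t + 1) + 2))" using s(2) by (rule of_nat_mono)
    then show ?thesis
      unfolding X_def using n s(1) by (intro powr_mono2) simp_all
  qed
  also have "\<dots> = 2 powr (real (?N * (t + 1) + 2) * (1 - 1 / real n))"
    by (simp only: powr_realpow[OF zero_less_numeral, symmetric] powr_powr)
  also have "\<dots> \<le> 2 powr (real ((n - 1) * (par_a n + 1) * t + (?N + 2)))"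
  proof (rule powr_mono)
    have "real (?N * t) * (1 - 1 / real n) = real ((n - 1) * (par_a n + 1) * t)"
      using n by (simp add: par_N_def field_simps of_nat_diff)
    moreover have "real (?N + 2) * (1 - 1 / real n) \<le> real (?N + 2) * 1"
      using n by (intro mult_left_mono) simp_all
    ultimately show "real (?N * (t + 1) + 2) * (1 - 1 / real n) \<le> real ((n - 1) * (par_a n + 1) * t + (?N + 2))"
      by (simp add: algebra_simps)
  qed simp
  also have "\<dots> = 2 ^ ((n - 1) * (par_a n + 1) * t + (?N + 2))"
    by (rule powr_realpow) simp
  also have "\<dots> = 2 ^ (?N + 2) * real ?u"
    unfolding par_u_def by (simp add: power_add)
  finally have X: "X \<le> 2 ^ (?N + 2) * real ?u" .
  have X0: "0 \<le> X" unfolding X_def by simp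
  have "(real n)\<^sup>2 \<le> 2 * real n * (real n - 1)"
    using n by (simp add: power2_eq_square algebra_simps)
  then have coeff: "(real n)\<^sup>2 / (real n - 1) \<le> 2 * real n"
    using n1 by (simp add: pos_divide_le_eq)
  have coeff0: "0 \<le> (real n)\<^sup>2 / (real n - 1)" using n1 by simp
  have "(1 - \<epsilon>) * ((real n)\<^sup>2 / (real n - 1)) * X * Y \<le> 1 * (2 * real n) * (2 ^ (?N + 2) * real ?u) * 1"
  proof (cases "\<epsilon> \<le> 1")
    case True
    then show ?thesis
      using \<epsilon> coeff coeff0 X X0 Y by (intro mult_mono) simp_all
  next
    case False
    then have "(1 - \<epsilon>) * ((real n)\<^sup>2 / (real n - 1)) \<le> 0"
      using coeff0 by (intro mult_nonpos_nonneg) simp_all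
    then have "(1 - \<epsilon>) * ((real n)\<^sup>2 / (real n - 1)) * X * Y \<le> 0"
      by (intro mult_nonpos_nonneg[OF mult_nonpos_nonneg[OF _ X0] Y(1)])
    also have "0 \<le> 1 * (2 * real n) * (2 ^ (?N + 2) * real ?u) * 1" by simp
    finally show ?thesis .
  qed
  also have "\<dots> = real (n * 2 ^ (?N + 4)) * real ?u / 2"
    by (simp add: power_add)
  also have "\<dots> \<le> real t * real ?u / 2"
    using of_nat_mono[OF t, where 'a = real] by (intro divide_right_mono mult_right_mono) simp_all
  also have "\<dots> \<le> real (t * ?u) * ln 2"
    using ln2_ge_two_thirds mult_left_mono[of "1 / 2" "ln 2 :: real" "real (t * ?u)"] by simp
  finally have "exp ((1 - \<epsilon>) * ((real n)\<^sup>2 / (real n - 1)) * X * Y) \<le> exp (real (t * ?u) * ln 2)"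
    by simp
  also have "\<dots> = 2 ^ (t * ?u)"
    by (simp only: exp_of_nat_mult exp_ln zero_less_numeral)
  finally show ?thesis unfolding X_def Y_def .
qed

text \<open>The last inequality bounds the primes of the cofactor, of the multiplier and of the
  coefficients by the \<open>2 * K\<close> places left in \<open>S\<close>, where
  \<open>K = 2 ^ (par_N n * t)\<close>. Their number is of order \<open>t * par_u n t\<close>, and
  \<open>K / par_u n t\<close> is at least \<open>2 ^ (2 * t)\<close>.\<close>

lemma parameter_size:
  fixes n c t :: nat
  assumes n: "n \<ge> 2" and t: "n * 2 ^ (par_N n + 4) + c \<le> t"
  shows "2 * n + 2 \<le> 2 ^ t" "4 * (par_N n + 1) * t \<le> 2 ^ t" "n + 4 \<le> t"
    "2 * ((par_N n + 1) * (2 * n + 2) * (t * par_u n t)) + n + c \<le> 2 * 2 ^ (par_N n * t)"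
proof -
  let ?N = "par_N n"
  have N: "16 * (?N + 1) \<le> 2 ^ (?N + 4)"
  proof -
    have "Suc ?N \<le> 2 ^ ?N" by (rule Suc_leI) (rule less_exp)
    then show ?thesis by (simp add: power_add)
  qed
  have nN: "n * (16 * (?N + 1)) \<le> n * 2 ^ (?N + 4)" using N by (rule mult_le_mono2)
  moreover have "16 * n \<le> n * (16 * (?N + 1))" by simp
  ultimately have t16: "16 * n + c \<le> t" using t by linarith
  then show "n + 4 \<le> t" using n by linarith
  have L: "2 * n + 2 \<le> t" using t16 n by linarith
  also have "t \<le> 2 ^ t" by (rule less_imp_le) (rule less_exp)
  finally show Lt: "2 * n + 2 \<le> 2 ^ t" .
  have "1 * (16 * (?N + 1)) \<le> n * (16 * (?N + 1))" using n by (intro mult_le_mono1) simp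
  then have "4 * (?N + 1) \<le> t" using nN t by linarith
  then have "4 * (?N + 1) * t \<le> t * t" by (rule mult_le_mono1)
  also have "t * t \<le> 2 ^ t"
  proof -
    have "4 \<le> t" using t16 n by linarith
    then show ?thesis
    proof (induction t rule: nat_induct_at_least)
      case (Suc m)
      then have "4 * m \<le> m * m" by (intro mult_le_mono1)
      then have "Suc m * Suc m \<le> 2 * (m * m)" using Suc.hyps unfolding mult_Suc mult_Suc_right by linarith
      then show ?case using Suc.IH by simp
    qed simp
  qed
  finally show b: "4 * (?N + 1) * t \<le> 2 ^ t" .
  have Nt: "2 ^ (?N * t) = par_u n t * 2 ^ ((par_a n + 1) * t)"
  proof -
    have "?N * t = (n - 1 + 1) * ((par_a n + 1) * t)"
      using n unfolding par_N_def by (simp only: mult.assoc) simp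
    also have "\<dots> = (n - 1) * (par_a n + 1) * t + (par_a n + 1) * t"
      by (simp only: add_mult_distrib mult_1 mult.assoc)
    finally show ?thesis unfolding par_u_def by (simp only: power_add)
  qed
  have "2 * ((?N + 1) * (2 * n + 2) * t) \<le> 4 * (?N + 1) * t * (2 * n + 2)"
    by (simp add: algebra_simps)
  also have "\<dots> \<le> 2 ^ t * 2 ^ t" using b Lt by (rule mult_le_mono)
  also have "\<dots> = 2 ^ (2 * t)" by (simp add: mult_2 power_add)
  also have "\<dots> \<le> 2 ^ ((par_a n + 1) * t)"
    by (intro power_increasing mult_le_mono1) (simp_all add: par_a_def)
  finally have "2 * ((?N + 1) * (2 * n + 2) * t) * par_u n t \<le> 2 ^ ((par_a n + 1) * t) * par_u n t"
    by (rule mult_le_mono1)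
  then have "2 * ((?N + 1) * (2 * n + 2) * (t * par_u n t)) \<le> 2 ^ (?N * t)"
    unfolding Nt by (simp only: ac_simps)
  moreover have "n + c \<le> 2 ^ (?N * t)"
  proof -
    have "n + c \<le> t" using t16 by linarith
    also have "\<dots> \<le> ?N * t" using n by (simp add: par_N_def)
    also have "\<dots> \<le> 2 ^ (?N * t)" by (rule less_imp_le) (rule less_exp)
    finally show ?thesis .
  qed
  ultimately show "2 * ((?N + 1) * (2 * n + 2) * (t * par_u n t)) + n + c \<le> 2 * 2 ^ (?N * t)"
    by linarith
qed

lemma two_power_le_threshold:
  assumes "n \<le> c"
  shows "2 ^ (par_N n * (n * 2 ^ (par_N n + 4) + c) + 2) \<le> threshold c"
proof -
  \<comment> \<open>\<open>par_N n\<close> is cubic in \<open>n\<close>, hence at most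
    \<open>11 * (c + 1) ^ 3\<close>, and \<open>E\<close> equals \<open>16 * (2 ^ c) ^ 3\<close>.
    The quantity to be bounded is singly exponential in \<open>par_N n\<close>, which explains
    \<open>2 ^ (8 * E)\<close> below.\<close>
  define E :: nat where "E = 2 ^ (3 * c + 4)"
  have c1: "c + 1 \<le> 2 ^ c" using less_exp[of c] by linarith
  have c3: "(2 ^ c) ^ 3 * 16 = E" unfolding E_def by (simp add: power_add flip: power_mult)
  have NE: "par_N n \<le> E"
  proof -
    have "par_N n \<le> c * (4 * (c + 1)\<^sup>2 + 7)"
    proof -
      have "(n + 1)\<^sup>2 \<le> (c + 1)\<^sup>2" using assms by (intro power_mono) auto
      then have "par_a n + 1 \<le> 4 * (c + 1)\<^sup>2 + 7" unfolding par_a_def by linarith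
      with assms show ?thesis unfolding par_N_def by (rule mult_le_mono)
    qed
    also have "\<dots> \<le> (c + 1) * (4 * (c + 1)\<^sup>2 + 7 * (c + 1)\<^sup>2)"
      by (intro mult_le_mono add_mono order_refl) (simp_all add: Suc_le_eq)
    also have "\<dots> = (c + 1) ^ 3 * 11" by (simp add: power3_eq_cube power2_eq_square algebra_simps)
    also have "\<dots> \<le> (2 ^ c) ^ 3 * 16" using c1 by (intro mult_le_mono power_mono) auto
    finally show ?thesis unfolding c3 .
  qed
  have "c \<le> 3 * c + 4" by simp
  also have "\<dots> \<le> E" unfolding E_def by (rule less_imp_le) (rule less_exp)
  finally have cE: "c \<le> E" .
  have E16: "16 \<le> E"
    unfolding E_def using power_increasing[of 4 "3 * c + 4" "2 :: nat"] by simp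
  have EE: "E \<le> 2 ^ E" by (rule less_imp_le) (rule less_exp)
  have "par_N n * (n * 2 ^ (par_N n + 4) + c) + 2 \<le> E * (E * 2 ^ (E + 4) + E * 2 ^ (E + 4)) + E * E * 2 ^ (E + 4)"
  proof (rule add_mono)
    show "par_N n * (n * 2 ^ (par_N n + 4) + c) \<le> E * (E * 2 ^ (E + 4) + E * 2 ^ (E + 4))"
    proof (intro mult_le_mono add_mono NE power_increasing)
      show "n \<le> E" using assms cE by simp
      have "c * 1 \<le> E * 2 ^ (E + 4)" using cE by (intro mult_le_mono) auto
      then show "c \<le> E * 2 ^ (E + 4)" by simp
    qed simp_all
    have "2 * 1 * 1 \<le> E * E * 2 ^ (E + 4)" using E16 by (intro mult_le_mono) auto
    then show "2 \<le> E * E * 2 ^ (E + 4)" by simp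
  qed
  also have "\<dots> = 3 * (E * E * 2 ^ (E + 4))" by (simp add: algebra_simps)
  also have "\<dots> \<le> 4 * (2 ^ E * 2 ^ E * 2 ^ (E + 4))"
    using EE by (intro mult_le_mono) auto
  also have "\<dots> = 2 ^ (3 * E + 6)" by (simp add: power_add algebra_simps eval_nat_numeral)
  also have "\<dots> \<le> 2 ^ (8 * E)" using E16 by (intro power_increasing) auto
  also have "8 * E = 2 ^ (3 * c + 7)" unfolding E_def by (simp add: power_add)
  also have "2 ^ 2 ^ (3 * c + 7) \<le> (2 :: nat) ^ 2 ^ 2 ^ (c + 4)"
  proof (intro power_increasing)
    show "3 * c + 7 \<le> 2 ^ (c + 4)" using c1 by (simp add: power_add)
  qed simp_all
  finally show ?thesis unfolding threshold_def by (intro power_increasing) simp_all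
qed

lemma exists_prime_superset:
  fixes R :: "nat set"
  assumes "finite R" "\<And>p. p \<in> R \<Longrightarrow> prime p" "card R \<le> s"
  obtains S where "finite S" "\<And>p. p \<in> S \<Longrightarrow> prime p" "card S = s" "R \<subseteq> S"
proof -
  have "infinite ({p::nat. prime p} - R)"
    using primes_infinite assms(1) by (rule Diff_infinite_finite[rotated])
  then obtain T where T: "T \<subseteq> {p. prime p} - R" "finite T" "card T = s - card R"
    using infinite_arbitrarily_large by metis
  show ?thesis
  proof (rule that[of "R \<union> T"])
    show "card (R \<union> T) = s"
      using T assms(1,3) by (subst card_Un_disjoint) auto
  qed (use T assms in auto)
qed

text \<open>The construction works only at scales \<open>K = 2 ^ (N * t)\<close>. For arbitrary
  \<open>s\<close> the largest \<open>t\<close> with \<open>4 * K \<le> s\<close> is used, and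
  \<open>S\<close> is filled up with further primes; a larger \<open>S\<close> keeps all
  solutions.\<close>

lemma many_solutions:
  fixes a :: "rat list" and \<epsilon> :: real
  assumes n: "n \<ge> 2" "length a = n" and a: "0 \<notin> set a" and \<epsilon>: "\<epsilon> > 0"
    and s: "s \<ge> threshold (rat_list_code a)"
  shows "\<exists>S::nat set. finite S \<and> (\<forall>p\<in>S. prime p) \<and> card S = s \<and>
    (\<exists>X. finite X \<and> (\<forall>x\<in>X. S_unit_solution S a x \<and> \<not> degenerate a x) \<and>
      real (card X) \<ge> exp ((1 - \<epsilon>) * ((real n)\<^sup>2 / (real n - 1)) *
        real s powr (1 - 1 / real n) * ln (real s) powr (- 1 / real n)))"
proof -
  define c where "c = rat_list_code a"
  define N where "N = par_N n"
  define t\<^sub>0 where "t\<^sub>0 = n * 2 ^ (par_N n + 4) + c"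
  have nc: "n \<le> c"
    unfolding c_def rat_list_code_def using length_le_list_encode[of "map rat_code a"] n(2) by simp
  have N0: "N > 0" unfolding N_def par_N_def using n by simp
  have s0: "2 ^ (N * t\<^sub>0 + 2) \<le> s"
    using two_power_le_threshold[OF nc] s unfolding N_def t\<^sub>0_def c_def by linarith
  have s1: "1 \<le> s" using s0 by (meson one_le_numeral one_le_power order_trans)
  obtain i where i: "2 ^ i \<le> s" "s < 2 ^ (i + 1)"
    using ex_power_ivl1[of 2 s] s1 by auto
  have "(2::nat) ^ (N * t\<^sub>0 + 2) < 2 ^ (i + 1)" using s0 i(2) by linarith
  then have "N * t\<^sub>0 + 2 < i + 1" by (rule power_less_imp_less_exp[rotated]) simp
  then have i0: "N * t\<^sub>0 + 2 \<le> i" by simp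
  \<comment> \<open>The 2 subtracted from the binary logarithm reserves the factor 4 in
    \<open>sK\<close>: \<open>2 * K\<close> places for \<open>P\<close> and \<open>2 * K\<close> for
    all other required primes.\<close>
  define t where "t = (i - 2) div N"
  have t: "t\<^sub>0 \<le> t" unfolding t_def using i0 N0 by (simp add: less_eq_div_iff_mult_less_eq mult.commute)
  have "N * t \<le> i - 2" unfolding t_def by simp
  then have Nt1: "N * t + 2 \<le> i" using i0 by linarith
  have "i - 2 < N * (t + 1)" unfolding t_def using N0 dividend_less_times_div[of N "i - 2"] by simp
  then have Nt2: "i + 1 \<le> N * (t + 1) + 2" using i0 by linarith
  have "(2::nat) ^ (N * t + 2) \<le> 2 ^ i" using Nt1 by (intro power_increasing) auto
  then have sK: "4 * 2 ^ (N * t) \<le> s" using i(1) by (simp add: power_add)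
  have "(2::nat) ^ (i + 1) \<le> 2 ^ (N * (t + 1) + 2)" using Nt2 by (intro power_increasing) auto
  then have sle: "s \<le> 2 ^ (N * (t + 1) + 2)" using i(2) by linarith
  note size = parameter_size[OF n(1) t[unfolded t\<^sub>0_def]]
  define \<xi> where "\<xi> = (N + 1) * (2 * n + 2) * (t * par_u n t)"
  obtain P d r D where P: "finite P" "\<forall>p\<in>P. prime p" "card P = 2 * 2 ^ (N * t)"
    and d: "0 < d" "d \<le> 2 ^ \<xi>" and r: "\<bar>r\<bar> \<le> int n * 2 ^ \<xi>" and D: "2 ^ (t * par_u n t) \<le> card D"
    and fam: "multiple_family n (P \<union> {p. prime p \<and> p dvd d}) r D"
    using multiple_family_for_parameters[OF n(1) size(1-3)] unfolding \<xi>_def N_def by blast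
  have r0: "r \<noteq> 0" using fam unfolding multiple_family_def by simp
  have dp: "{p. prime p \<and> p dvd d} = prime_factors d" using d(1) by (auto simp: in_prime_factors_iff)
  have rp: "{p. prime p \<and> int p dvd r} = prime_factors (nat \<bar>r\<bar>)"
    using r0 by (auto simp: in_prime_factors_iff nat_dvd_iff int_dvd_int_iff[symmetric])
  \<comment> \<open>All primes that \<open>S\<close> must contain: those of the summands and the
    moduli, of the multiplier, of the cofactor, and of the coefficients.\<close>
  define R where "R = P \<union> prime_factors d \<union> (prime_factors (nat \<bar>r\<bar>) \<union> {p. prime p \<and> p \<le> c})"
  have finR: "finite R" unfolding R_def using P(1) by simp
  have "card R \<le> card P + card (prime_factors d) + (card (prime_factors (nat \<bar>r\<bar>)) + card {p::nat. prime p \<and> p \<le> c})"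
    unfolding R_def by (intro order_trans[OF card_Un_le] add_mono order_refl card_Un_le)
  also have "\<dots> \<le> 2 * 2 ^ (N * t) + \<xi> + ((n + \<xi>) + c)"
  proof (intro add_mono)
    show "card P \<le> 2 * 2 ^ (N * t)" using P(3) by simp
    show "card (prime_factors d) \<le> \<xi>" using d by (rule card_prime_factors_le_log2)
    note r
    also have "int n * 2 ^ \<xi> \<le> 2 ^ n * 2 ^ \<xi>"
      using of_nat_less_two_power[of n, where 'a = int] by (intro mult_right_mono) simp_all
    finally have "nat \<bar>r\<bar> \<le> 2 ^ (n + \<xi>)"
      by (simp add: power_add nat_le_iff)
    then show "card (prime_factors (nat \<bar>r\<bar>)) \<le> n + \<xi>"
      using r0 by (intro card_prime_factors_le_log2) auto
    have "card {p::nat. prime p \<and> p \<le> c} \<le> card {1..c}"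
      by (intro card_mono) (auto simp: Suc_le_eq prime_gt_0_nat)
    then show "card {p::nat. prime p \<and> p \<le> c} \<le> c" by simp
  qed
  also have "\<dots> \<le> 4 * 2 ^ (N * t)" using size(4) unfolding \<xi>_def N_def by linarith
  finally have "card R \<le> s" using sK by linarith
  moreover have "prime p" if "p \<in> R" for p using that P(2) unfolding R_def by auto
  ultimately obtain S where S: "finite S" "\<And>p. p \<in> S \<Longrightarrow> prime p" "card S = s" "R \<subseteq> S"
    using exists_prime_superset[OF finR, of s] by metis
  have "P \<union> {p. prime p \<and> p dvd d} \<subseteq> S"
    using S(4) unfolding R_def dp by auto
  with fam have "multiple_family n S r D"
    by (rule multiple_family_mono)
  moreover have "p \<in> S" if x: "x \<in> set a" and p: "prime p"
    "int p dvd fst (quotient_of x) \<or> int p dvd snd (quotient_of x)" for x p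
  proof -
    obtain y z where yz: "quotient_of x = (y, z)" by (cases "quotient_of x")
    have "x = of_int y / of_int z" by (rule quotient_of_div[OF yz])
    moreover have "x \<noteq> 0" using a x by auto
    ultimately have y0: "y \<noteq> 0" by auto
    have z0: "z > 0" by (rule quotient_of_denom_pos[OF yz])
    have "\<bar>y\<bar> \<le> int c" "\<bar>z\<bar> \<le> int c"
      using quotient_of_le_rat_list_code[OF x] z0 unfolding c_def yz by simp_all
    moreover have "int p \<le> \<bar>y\<bar> \<or> int p \<le> \<bar>z\<bar>"
      using p(2) y0 z0 dvd_imp_le_int[of y "int p"] dvd_imp_le_int[of z "int p"] unfolding yz by auto
    ultimately have "p \<le> c" by auto
    then show ?thesis using S(4) p(1) unfolding R_def by auto
  qed
  moreover have "p \<in> S" if "prime p" "int p dvd r" for p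
    using that rp S(4) unfolding R_def by auto
  ultimately obtain X where X: "finite X" "card X = card D" "\<forall>x\<in>X. S_unit_solution S a x \<and> \<not> degenerate a x"
    using S_unit_solutions_of_multiple_family[of n S r D a] a n by auto
  have "4 * 1 \<le> 4 * (2::nat) ^ (N * t)" by (intro mult_le_mono) auto
  then have s4: "4 \<le> s" using sK by linarith
  have "n * 2 ^ (par_N n + 4) \<le> t" using t unfolding t\<^sub>0_def by linarith
  then have "exp ((1 - \<epsilon>) * ((real n)\<^sup>2 / (real n - 1)) * real s powr (1 - 1 / real n) *
      ln (real s) powr (- 1 / real n)) \<le> 2 ^ (t * par_u n t)"
    by (rule target_le_two_power[OF n(1) s4 sle[unfolded N_def] _ \<epsilon>])
  also have "\<dots> = real (2 ^ (t * par_u n t))" by simp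
  also have "\<dots> \<le> real (card X)" unfolding X(2) using D by (rule of_nat_mono)
  finally show ?thesis
    using S(1-3) X(1,3) by (intro exI[of _ S] conjI exI[of _ X]) auto
qed

theorem theorem1:
  "\<exists>P. \<forall>(n::nat) (\<epsilon>::real) (a::rat list) \<phi>.
     n \<ge> 2 \<and> \<epsilon> > 0 \<and> length a = n \<and> 0 \<notin> set a \<and> represents_real \<phi> \<epsilon> \<longrightarrow>
     (\<exists>s\<^sub>0::nat. s\<^sub>0 > 0 \<and> computes \<phi> P [rat_list_code a] s\<^sub>0 \<and>
       (\<forall>s\<ge>s\<^sub>0. \<exists>S::nat set. finite S \<and> (\<forall>p\<in>S. prime p) \<and> card S = s \<and>
         (\<exists>X. finite X \<and> (\<forall>x\<in>X. S_unit_solution S a x \<and> \<not> degenerate a x) \<and>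
           real (card X) \<ge>
             exp ((1 - \<epsilon>) * ((real n)\<^sup>2 / (real n - 1)) *
               real s powr (1 - 1 / real n) * ln (real s) powr (- 1 / real n)))))"
proof (intro exI[of _ threshold_prog] allI impI)
  fix n :: nat and \<epsilon> :: real and a :: "rat list" and \<phi>
  assume "n \<ge> 2 \<and> \<epsilon> > 0 \<and> length a = n \<and> 0 \<notin> set a \<and> represents_real \<phi> \<epsilon>"
  then show "\<exists>s\<^sub>0::nat. s\<^sub>0 > 0 \<and> computes \<phi> threshold_prog [rat_list_code a] s\<^sub>0 \<and>
       (\<forall>s\<ge>s\<^sub>0. \<exists>S::nat set. finite S \<and> (\<forall>p\<in>S. prime p) \<and> card S = s \<and>
         (\<exists>X. finite X \<and> (\<forall>x\<in>X. S_unit_solution S a x \<and> \<not> degenerate a x) \<and>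
           real (card X) \<ge>
             exp ((1 - \<epsilon>) * ((real n)\<^sup>2 / (real n - 1)) *
               real s powr (1 - 1 / real n) * ln (real s) powr (- 1 / real n))))"
    using computes_threshold_prog many_solutions
    by (intro exI[of _ "threshold (rat_list_code a)"] conjI allI impI) (auto simp: threshold_def)
qed

end
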